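(* Let $T\subset\mathbb{R}^n$ be a hyperplane perpendicular to $\mathbf{e}$, let $\Sigma$ be the open half-space on one side of $T$, and let $\tilde x$ denote the reflection of $x$ with respect to $T$. Assume that $w\in\mathcal{L}_s(\mathbb{R}^n)\cap C^{1,1}_{loc}(\Sigma)$ is bounded from below in $\Sigma$ and $w(\tilde x)=-w(x)$ in $\Sigma$. Suppose that, at any point $x\in\Sigma$ such that $w(x)<0$, $w$ satisfies $$\mathbf{F_s}w(x)-c(x)w(x)\le 0,$$ where $c(x)\ge 0$ in $\{x\in\Sigma : w(x)<0\}$. Then $$w(x)\ge 0\qquad\forall\, x\in\Sigma.$$ Furthermore, assume in addition that $\mathbf{F_s}w(x)\le 0$ at points $x\in\Sigma$ where $w(x)=0$. Then either $w>0$ in $\Sigma$ or $w=0$ in $\mathbb{R}^n$.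
   Context: Let $n\ge 2$, $0<s<1$ and $0<\theta\le\Theta<\infty$. $\mathcal{L}_s(\mathbb{R}^n)$ is the set of functions $u:\mathbb{R}^n\to\mathbb{R}$ with $\int_{\mathbb{R}^n}\frac{|u(x)|}{1+|x|^{n+2s}}\,dx<+\infty$. $C^{1,1}_{loc}(\Sigma)$ denotes functions that are $C^1$ with locally Lipschitz gradient in $\Sigma$. Fix a unit vector $\mathbf{e}\in\mathbb{R}^n$. For $u\in\mathcal{L}_s(\mathbb{R}^n)$ that is $C^{1,1}$ near $x$, $$\mathbf{F_s}u(x):=\inf\left\{P.V.\int_{\mathbb{R}^n}\frac{u(y)-u(x)}{|A^{-1}(y-x)|^{n+2s}}\,dy \;:\; A \text{ a real symmetric } n\times n \text{ matrix},\ \theta I\le A\le\Theta I,\ \mathbf{e} \text{ is an eigenvector of } A\right\}.$$ P.V. denotes the Cauchy principal value.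
   Formalization: Antisymmetry in Σ leaves w free on T (w=0 off T, w=1 on T is a counterexample), so the last alternative is proved as w=0 at every point off T, and as w=0 in all of R^n when w(x̃)=-w(x) is also assumed for x in T. *)

theory Defs
  imports "HOL-Analysis.Analysis"
begin

text \<open>Weighted \<open>L\<^sup>1\<close> space of functions of growth order less than \<open>2 s\<close> at infinity.
  Measurability is stated separately because integrability of \<open>\<bar>u\<bar>\<close> alone does not imply it.\<close>

definition L_space :: "real \<Rightarrow> (real ^ 'n \<Rightarrow> real) set" where
  "L_space s = {u. u \<in> borel_measurable lebesgue \<and>
     integrable lebesgue (\<lambda>x. \<bar>u x\<bar> / (1 + norm x powr (real CARD('n) + 2 * s)))}"

definition C11_loc :: "'a::real_inner set \<Rightarrow> ('a \<Rightarrow> real) set" where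
  "C11_loc U = {f. \<exists>g. (\<forall>x\<in>U. GDERIV f x :> g x) \<and>
     (\<forall>x\<in>U. \<exists>r>0. \<exists>L. L-lipschitz_on (ball x r \<inter> U) g)}"

definition pv_integral :: "(real ^ 'n \<Rightarrow> real) \<Rightarrow> real ^ 'n \<Rightarrow> real" where
  "pv_integral f x = Lim (at_right 0) (\<lambda>\<epsilon>. LINT y : - ball x \<epsilon> | lebesgue. f y)"

definition symmetric_matrix :: "real ^ 'n ^ 'n \<Rightarrow> bool" where
  "symmetric_matrix A \<longleftrightarrow> transpose A = A"

definition loewner_le :: "real ^ 'n ^ 'n \<Rightarrow> real ^ 'n ^ 'n \<Rightarrow> bool" where
  "loewner_le A B \<longleftrightarrow> (\<forall>x. 0 \<le> x \<bullet> ((B - A) *v x))"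

definition is_eigenvector :: "real ^ 'n ^ 'n \<Rightarrow> real ^ 'n \<Rightarrow> bool" where
  "is_eigenvector A v \<longleftrightarrow> v \<noteq> 0 \<and> (\<exists>l. A *v v = l *\<^sub>R v)"

text \<open>In the next definition, \<^term>\<open>mat \<theta>\<close> is the scalar matrix \<open>\<theta> I\<close>.\<close>

definition admissible :: "real \<Rightarrow> real \<Rightarrow> real ^ 'n \<Rightarrow> (real ^ 'n ^ 'n) set" where
  "admissible \<theta> \<Theta> e = {A. symmetric_matrix A \<and> loewner_le (mat \<theta>) A \<and> loewner_le A (mat \<Theta>)
     \<and> is_eigenvector A e}"

text \<open>The operator is meant to be evaluated at \<open>x\<close> for \<open>u \<in> L_space s\<close> that is \<open>C\<^bsup>1,1\<^esup>\<close> near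
  \<open>x\<close>, with \<open>0 < s < 1\<close>, \<open>0 < \<theta> \<le> \<Theta>\<close> and \<open>e \<noteq> 0\<close>: then all the principal values exist and
  are bounded uniformly in \<open>A\<close>, so that the limit and the real infimum are the genuine ones.\<close>

definition F_op :: "real \<Rightarrow> real \<Rightarrow> real \<Rightarrow> real ^ 'n \<Rightarrow> (real ^ 'n \<Rightarrow> real) \<Rightarrow> real ^ 'n \<Rightarrow> real" where
  "F_op s \<theta> \<Theta> e u x = (INF A \<in> admissible \<theta> \<Theta> e.
     pv_integral (\<lambda>y. (u y - u x) / norm (matrix_inv A *v (y - x)) powr (real CARD('n) + 2 * s)) x)"

text \<open>Reflection in the hyperplane \<open>{x. e \<bullet> x = b}\<close>, for a unit vector \<open>e\<close>.\<close>

definition reflect :: "real ^ 'n \<Rightarrow> real \<Rightarrow> real ^ 'n \<Rightarrow> real ^ 'n" where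
  "reflect e b x = x - (2 * (e \<bullet> x - b)) *\<^sub>R e"

end

theory Submission
  imports Defs
begin

text \<open>Write \<open>K\<close> for the kernel of an admissible \<open>A\<close>, \<open>\<rho>\<close> for the reflection. Since \<open>e\<close> is an
  eigenvector of \<open>A\<close>, \<open>K (y - x) \<ge> K (\<rho> y - x)\<close> for \<open>x\<close>, \<open>y\<close> in \<open>\<Sigma>\<close>, and folding the principal
  value at \<open>x\<close> onto \<open>\<Sigma>\<close> gives the integrand
  \<open>(w y - w x) (K (y - x) - K (\<rho> y - x)) - 2 w x K (\<rho> y - x)\<close>.
  If \<open>w\<close> has infimum \<open>- m < 0\<close>, minimise \<open>w + 2 \<epsilon> (norm (y - x0) / r)\<^sup>2\<close>, where \<open>w x0 < - m + \<epsilon>\<close> and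
  \<open>2 r\<close> is the distance of \<open>x0\<close> to the hyperplane. At the minimum point the first term is at least
  of order \<open>- \<epsilon>\<close> and the second of order \<open>m\<close>, both in units of \<open>r\<^bsup>- 2 s\<^esup>\<close> and uniformly in \<open>A\<close>,
  so the operator is positive there: a contradiction. At a zero of \<open>w \<ge> 0\<close> only the first term
  remains; it is nonnegative, and bounded below uniformly in \<open>A\<close> unless \<open>w\<close> vanishes on \<open>\<Sigma>\<close>.\<close>

subsection \<open>Lebesgue measure and isometries\<close>

lemma nn_integral_lborel_translation:
  fixes f :: "'a::euclidean_space \<Rightarrow> ennreal"
  assumes [measurable]: "f \<in> borel_measurable borel"
  shows "(\<integral>\<^sup>+x. f (x + t) \<partial>lborel) = (\<integral>\<^sup>+x. f x \<partial>lborel)"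
proof -
  have "(\<integral>\<^sup>+x. f x \<partial>lborel) = (\<integral>\<^sup>+x. f x \<partial>density (distr lborel borel (\<lambda>x. t + 1 *\<^sub>R x)) (\<lambda>_. ennreal (\<bar>1\<bar>^DIM('a))))"
    using lborel_affine[of 1 t] by simp
  also have "\<dots> = (\<integral>\<^sup>+x. f (t + x) \<partial>lborel)"
    by (subst nn_integral_density) (auto simp: nn_integral_distr)
  finally show ?thesis by (simp add: add.commute)
qed

text \<open>Uniqueness of Haar measure in miniature: with \<open>g\<close> the indicator of the unit ball, Fubini's theorem
  turns \<open>\<integral>f \<circ> R \<cdot> \<integral>g\<close> into \<open>\<integral>f \<cdot> \<integral>g\<close>. The change of variables theorems of the library ask for a
  well-ordered index type.\<close>

lemma nn_integral_lborel_orthogonal: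
  fixes f :: "'a::euclidean_space \<Rightarrow> ennreal" and R :: "'a \<Rightarrow> 'a"
  assumes R: "orthogonal_transformation R" and f[measurable]: "f \<in> borel_measurable borel"
  shows "(\<integral>\<^sup>+x. f (R x) \<partial>lborel) = (\<integral>\<^sup>+x. f x \<partial>lborel)"
proof -
  have lin: "linear R" and surj: "surj R" and nrm: "norm (R x) = norm x" for x
    using R by (simp_all add: orthogonal_transformation_linear orthogonal_transformation_surj
      orthogonal_transformation_norm)
  have [measurable]: "R \<in> borel_measurable borel"
    using lin by (intro borel_measurable_continuous_onI linear_continuous_on)
      (simp add: linear_conv_bounded_linear)
  define g :: "'a \<Rightarrow> ennreal" where "g y = indicator (ball 0 1) y" for y
  have [measurable]: "g \<in> borel_measurable borel"
    unfolding g_def by (intro borel_measurable_indicator) auto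
  define c where "c = (\<integral>\<^sup>+y. g y \<partial>(lborel::'a measure))"
  have c: "c = unit_ball_vol (real DIM('a))"
    by (simp add: c_def g_def emeasure_ball)
  have tr: "(\<integral>\<^sup>+x. f (R x + y) \<partial>lborel) = (\<integral>\<^sup>+x. f (R x) \<partial>lborel)" for y
  proof -
    obtain y' where y': "y = R y'" using surj by (metis surjD)
    have "f (R x + y) = f (R (x + y'))" for x
      using lin by (simp add: y' linear_add)
    then show ?thesis
      using nn_integral_lborel_translation[of "\<lambda>x. f (R x)" y'] by simp
  qed
  \<comment> \<open>\<open>R\<close> preserves distances, so the unit ball about
    \<open>y = R y'\<close> pulls back to the unit ball about \<open>y'\<close>.\<close>
  have shell: "(\<integral>\<^sup>+x. g (y - R x) \<partial>lborel) = c" for y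
  proof -
    obtain y' where y': "y = R y'" using surj by (metis surjD)
    have "norm (R y' - R x) = dist y' x" for x
      using lin nrm[of "y' - x"] by (simp add: linear_diff dist_norm)
    then have "g (y - R x) = indicator (ball y' 1) x" for x
      by (simp add: g_def y' indicator_def)
    then show ?thesis by (simp add: c emeasure_ball)
  qed
  have "(\<integral>\<^sup>+x. f (R x) \<partial>lborel) * c = (\<integral>\<^sup>+y. (\<integral>\<^sup>+x. f (R x + y) * g y \<partial>lborel) \<partial>lborel)"
    by (simp add: nn_integral_multc tr nn_integral_cmult c_def)
  also have "\<dots> = (\<integral>\<^sup>+x. (\<integral>\<^sup>+y. f (R x + y) * g y \<partial>lborel) \<partial>lborel)"
    by (rule lborel_pair.Fubini') measurable
  also have "\<dots> = (\<integral>\<^sup>+x. (\<integral>\<^sup>+y. f y * g (y - R x) \<partial>lborel) \<partial>lborel)"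
  proof (rule nn_integral_cong)
    fix x
    show "(\<integral>\<^sup>+y. f (R x + y) * g y \<partial>lborel) = (\<integral>\<^sup>+y. f y * g (y - R x) \<partial>lborel)"
      using nn_integral_lborel_translation[of "\<lambda>y. f y * g (y - R x)" "R x"]
      by (simp add: add.commute)
  qed
  also have "\<dots> = (\<integral>\<^sup>+y. (\<integral>\<^sup>+x. f y * g (y - R x) \<partial>lborel) \<partial>lborel)"
    by (rule lborel_pair.Fubini') measurable
  also have "\<dots> = (\<integral>\<^sup>+y. f y \<partial>lborel) * c"
    by (simp add: nn_integral_cmult shell nn_integral_multc)
  finally have "(\<integral>\<^sup>+x. f (R x) \<partial>lborel) * c / c = (\<integral>\<^sup>+x. f x \<partial>lborel) * c / c"
    by simp
  moreover have "c \<noteq> 0" "c \<noteq> top"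
    by (simp_all add: c less_imp_neq[symmetric])
  ultimately show ?thesis
    by (simp add: mult_divide_eq_ennreal)
qed

text \<open>A map that preserves \<open>lborel\<close> pulls null sets back to null sets, so it
  stays measurable and measure preserving between the completions.\<close>

lemma distr_lebesgue_isometry:
  fixes R :: "'a::euclidean_space \<Rightarrow> 'a"
  assumes R: "orthogonal_transformation R"
  shows "(\<lambda>x. t + R x) \<in> lebesgue \<rightarrow>\<^sub>M lebesgue"
    and "distr lebesgue lebesgue (\<lambda>x. t + R x) = lebesgue"
proof -
  define T where "T x = t + R x" for x
  have [measurable]: "R \<in> borel_measurable borel"
    using orthogonal_transformation_linear[OF R]
    by (intro borel_measurable_continuous_onI linear_continuous_on)
      (simp add: linear_conv_bounded_linear)
  then have T[measurable]: "T \<in> borel_measurable borel"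
    unfolding T_def by measurable
  have distr: "distr lborel lborel T = lborel"
  proof (rule measure_eqI)
    fix A assume "A \<in> sets (distr lborel lborel T)"
    then have [measurable]: "A \<in> sets borel" by simp
    have "emeasure (distr lborel lborel T) A = (\<integral>\<^sup>+x. indicator A x \<partial>distr lborel lborel T)"
      by simp
    also have "\<dots> = (\<integral>\<^sup>+x. indicator A (R x + t) \<partial>lborel)"
      by (subst nn_integral_distr) (auto simp: T_def add.commute)
    also have "\<dots> = (\<integral>\<^sup>+x. indicator A (x + t) \<partial>lborel)"
      by (rule nn_integral_lborel_orthogonal[OF R, where f="\<lambda>x. indicator A (x + t)"]) measurable
    also have "\<dots> = emeasure lborel A"
      by (subst nn_integral_lborel_translation) auto
    finally show "emeasure (distr lborel lborel T) A = emeasure lborel A" .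
  qed simp
  have T': "T \<in> lebesgue \<rightarrow>\<^sub>M lborel"
    by (simp add: measurable_completion)
  have distr': "distr lebesgue lborel T = lborel"
    using distr by (simp add: distr_completion)
  show "(\<lambda>x. t + R x) \<in> lebesgue \<rightarrow>\<^sub>M lebesgue"
    unfolding T_def[symmetric, abs_def] using T' distr'
    by (simp add: completion.measurable_completion2)
  show "distr lebesgue lebesgue (\<lambda>x. t + R x) = lebesgue"
    unfolding T_def[symmetric, abs_def]
    using completion.completion_distr_eq[OF T'] distr' by simp
qed

subsection \<open>Integrals of powers of the norm\<close>

text \<open>On each shell the power is at most its value at the inner radius, as
  \<open>b \<le> 0\<close>, and the shell lies in a ball of known volume. The bounds form a
  geometric series of ratio \<open>t powr (n + b)\<close>, with \<open>n\<close> the dimension.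
  Taking \<open>t = 2\<close> covers the outside of a ball, \<open>t = 1/2\<close> a punctured
  ball.\<close>

lemma nn_integral_norm_powr_dyadic:
  fixes b t :: real
  assumes "b \<le> 0" and t: "0 < t" "t powr (real DIM('a) + b) < 1"
  obtains C where "0 \<le> C"
    and "\<And>r S. 0 < r \<Longrightarrow> S \<subseteq> (\<Union>k. {z::'a::euclidean_space. r * t ^ k / 2 \<le> norm z \<and> norm z < r * t ^ k}) \<Longrightarrow>
      (\<integral>\<^sup>+z. ennreal (indicator S z * norm z powr b) \<partial>lborel) \<le> ennreal (C * r powr (real DIM('a) + b))"
proof -
  let ?n = "real DIM('a)"
  let ?q = "t powr (?n + b)"
  define D where "D = 2 powr (- b) * unit_ball_vol ?n"
  have D: "0 \<le> D" by (simp add: D_def)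
  have q: "0 \<le> ?q" "?q < 1" using t by auto
  show thesis
  proof (rule that)
    show "0 \<le> D / (1 - ?q)" using D q by simp
  next
    fix r :: real and S :: "'a set"
    assume r: "0 < r" and S: "S \<subseteq> (\<Union>k. {z. r * t ^ k / 2 \<le> norm z \<and> norm z < r * t ^ k})"
    define h :: "nat \<Rightarrow> 'a \<Rightarrow> ennreal"
      where "h k z = ennreal ((r * t ^ k / 2) powr b) * indicator (ball 0 (r * t ^ k)) z" for k z
    have [measurable]: "ball (0::'a) \<rho> \<in> sets borel" for \<rho> by simp
    have [measurable]: "h k \<in> borel_measurable borel" for k
      unfolding h_def by measurable
    have "(\<integral>\<^sup>+z. ennreal (indicator S z * norm z powr b) \<partial>lborel) \<le> (\<integral>\<^sup>+z. (\<Sum>k. h k z) \<partial>lborel)"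
    proof (rule nn_integral_mono)
      fix z :: 'a
      show "ennreal (indicator S z * norm z powr b) \<le> (\<Sum>k. h k z)"
      proof (cases "z \<in> S")
        case True
        then obtain k where k: "r * t ^ k / 2 \<le> norm z" "norm z < r * t ^ k"
          using S by blast
        have "norm z powr b \<le> (r * t ^ k / 2) powr b"
          using k r t \<open>b \<le> 0\<close> by (intro powr_mono2') auto
        then have "ennreal (indicator S z * norm z powr b) \<le> h k z"
          using True k by (simp add: h_def ennreal_leI)
        also have "\<dots> = sum (\<lambda>k. h k z) {k}" by simp
        also have "\<dots> \<le> (\<Sum>k. h k z)"
          by (rule sum_le_suminf) (auto simp: summableI)
        finally show ?thesis .
      qed simp
    qed
    also have "\<dots> = (\<Sum>k. (\<integral>\<^sup>+z. h k z \<partial>lborel))"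
      by (rule nn_integral_suminf) simp
    also have "\<dots> = (\<Sum>k. ennreal (D * r powr (?n + b) * ?q ^ k))"
    proof (rule suminf_cong)
      fix k
      have p: "0 < r * t ^ k" using r t by simp
      have "(\<integral>\<^sup>+z. h k z \<partial>lborel) = ennreal ((r * t ^ k / 2) powr b) * emeasure lborel (ball (0::'a) (r * t ^ k))"
        unfolding h_def by (subst nn_integral_cmult_indicator) auto
      also have "\<dots> = ennreal ((r * t ^ k / 2) powr b * (unit_ball_vol ?n * (r * t ^ k) powr ?n))"
        using p by (simp add: emeasure_ball ennreal_mult' powr_realpow)
      also have "(r * t ^ k / 2) powr b * (unit_ball_vol ?n * (r * t ^ k) powr ?n)
          = D * (r * t ^ k) powr (?n + b)"
        using p by (simp add: D_def powr_divide powr_add powr_minus_divide)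
      also have "\<dots> = D * r powr (?n + b) * ?q ^ k"
        using r t by (simp add: powr_mult powr_power powr_realpow[symmetric] powr_powr mult.commute)
      finally show "(\<integral>\<^sup>+z. h k z \<partial>lborel) = ennreal (D * r powr (?n + b) * ?q ^ k)" .
    qed
    also have "\<dots> = ennreal (D * r powr (?n + b) * (1 / (1 - ?q)))"
      using q D by (intro suminf_ennreal_eq sums_mult geometric_sums) auto
    finally show "(\<integral>\<^sup>+z. ennreal (indicator S z * norm z powr b) \<partial>lborel)
        \<le> ennreal (D / (1 - ?q) * r powr (?n + b))"
      by (simp add: mult.commute mult.left_commute)
  qed
qed

lemma integrable_lebesgue_translate:
  fixes f :: "'a::euclidean_space \<Rightarrow> real"
  assumes f[measurable]: "f \<in> borel_measurable borel" and "\<And>z. 0 \<le> f z" and "0 \<le> c"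
    and le: "(\<integral>\<^sup>+z. ennreal (f z) \<partial>lborel) \<le> ennreal c"
  shows "integrable lebesgue (\<lambda>y. f (y - x))" and "(LINT y|lebesgue. f (y - x)) \<le> c"
proof -
  have "(\<integral>\<^sup>+y. ennreal (f (y - x)) \<partial>lborel) = (\<integral>\<^sup>+z. ennreal (f z) \<partial>lborel)"
    using nn_integral_lborel_translation[of "\<lambda>z. ennreal (f z)" "- x"] by simp
  then have le': "(\<integral>\<^sup>+y. ennreal (f (y - x)) \<partial>lborel) \<le> ennreal c" using le by simp
  have m[measurable]: "(\<lambda>y. f (y - x)) \<in> borel_measurable borel" by measurable
  have i: "integrable lborel (\<lambda>y. f (y - x))"
    using le' \<open>\<And>z. 0 \<le> f z\<close> by (intro integrableI_nonneg) (auto simp: le_less_trans)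
  then show "integrable lebesgue (\<lambda>y. f (y - x))"
    by (simp add: integrable_completion)
  have "ennreal (LINT y|lborel. f (y - x)) \<le> ennreal c"
    using nn_integral_eq_integral[OF i] \<open>\<And>z. 0 \<le> f z\<close> le' by simp
  then show "(LINT y|lebesgue. f (y - x)) \<le> c"
    using \<open>0 \<le> c\<close> by (simp add: integral_completion ennreal_le_iff)
qed

text \<open>Shells of growing radius exhaust the complement of the ball, and the series converges as
  \<open>N\<close> exceeds the dimension. One constant serves all centres and radii; the scaling
  argument in \<open>r\<close> relies on this.\<close>

lemma integral_norm_powr_outside_ball:
  fixes N :: real
  assumes "real DIM('a) < N"
  obtains C where "0 \<le> C"
    and "\<And>r (x::'a::euclidean_space). 0 < r \<Longrightarrow>
      integrable lebesgue (\<lambda>y. indicator (- ball x r) y * norm (y - x) powr (- N))"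
    and "\<And>r (x::'a). 0 < r \<Longrightarrow>
      (LINT y|lebesgue. indicator (- ball x r) y * norm (y - x) powr (- N)) \<le> C * r powr (real DIM('a) - N)"
proof -
  obtain C where C: "0 \<le> C" and
    le: "\<And>r S. 0 < r \<Longrightarrow> S \<subseteq> (\<Union>k. {z::'a. r * 2 ^ k / 2 \<le> norm z \<and> norm z < r * 2 ^ k}) \<Longrightarrow>
      (\<integral>\<^sup>+z. ennreal (indicator S z * norm z powr (- N)) \<partial>lborel)
        \<le> ennreal (C * r powr (real DIM('a) + - N))"
    by (rule nn_integral_norm_powr_dyadic[of "- N" 2, where 'a='a])
      (use assms in \<open>auto simp: powr_less_one\<close>)
  have sub: "- ball 0 r \<subseteq> (\<Union>k. {z::'a. r * 2 ^ k / 2 \<le> norm z \<and> norm z < r * 2 ^ k})"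
    if r: "0 < r" for r :: real
  proof
    fix z :: 'a assume "z \<in> - ball 0 r"
    then have z: "r \<le> norm z" by simp
    define k where "k = (LEAST k. norm z < r * 2 ^ k)"
    obtain k0 where "norm z / r < 2 ^ k0" using real_arch_pow[of 2 "norm z / r"] by auto
    then have "norm z < r * 2 ^ k0" using r by (simp add: field_simps)
    then have k: "norm z < r * 2 ^ k" unfolding k_def by (rule LeastI)
    with z obtain j where j: "k = Suc j" by (cases k) auto
    then have "\<not> norm z < r * 2 ^ j" unfolding k_def by (metis lessI not_less_Least)
    with k j show "z \<in> (\<Union>k. {z::'a. r * 2 ^ k / 2 \<le> norm z \<and> norm z < r * 2 ^ k})"
      by (auto intro!: exI[of _ k])
  qed
  define f where "f r z = indicator (- ball 0 r) z * norm z powr (- N)" for r and z :: 'a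
  have eq: "f r (y - x) = indicator (- ball x r) y * norm (y - x) powr (- N)" for x y r
    by (simp add: f_def indicator_def dist_norm norm_minus_commute)
  have m: "f r \<in> borel_measurable borel" for r
    unfolding f_def by (intro borel_measurable_times borel_measurable_indicator) auto
  note * = integrable_lebesgue_translate[OF m _ _ le[OF _ sub, folded f_def], unfolded eq add_uminus_conv_diff]
  show thesis
    by (rule that[OF C]; rule *) (use C in \<open>auto simp: f_def\<close>)
qed

text \<open>The square lowers the singularity to the exponent \<open>2 - N\<close>, integrable at
  the centre by the upper bound on \<open>N\<close>; \<open>2 \<le> N\<close> keeps this exponent
  nonpositive, as the shell estimate asks.\<close>

lemma integral_norm_powr_ball:
  fixes N :: real
  assumes "N < real DIM('a) + 2" and "2 \<le> N"
  obtains C where "0 \<le> C"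
    and "\<And>r (x::'a::euclidean_space). 0 < r \<Longrightarrow>
      integrable lebesgue (\<lambda>y. indicator (ball x r) y * ((norm (y - x))\<^sup>2 * norm (y - x) powr (- N)))"
    and "\<And>r (x::'a). 0 < r \<Longrightarrow>
      (LINT y|lebesgue. indicator (ball x r) y * ((norm (y - x))\<^sup>2 * norm (y - x) powr (- N)))
        \<le> C * r powr (real DIM('a) + 2 - N)"
proof -
  obtain C where C: "0 \<le> C" and
    le: "\<And>r S. 0 < r \<Longrightarrow> S \<subseteq> (\<Union>k. {z::'a. r * (1/2) ^ k / 2 \<le> norm z \<and> norm z < r * (1/2) ^ k}) \<Longrightarrow>
      (\<integral>\<^sup>+z. ennreal (indicator S z * norm z powr (2 - N)) \<partial>lborel)
        \<le> ennreal (C * r powr (real DIM('a) + (2 - N)))"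
    by (rule nn_integral_norm_powr_dyadic[of "2 - N" "1/2", where 'a='a])
      (use assms in \<open>auto simp: powr_less_one powr_divide powr_less_cancel_iff\<close>)
  \<comment> \<open>The centre lies in no shell. It is removed without loss, since the squared norm
    vanishes there.\<close>
  have sub: "ball 0 r - {0} \<subseteq> (\<Union>k. {z::'a. r * (1/2) ^ k / 2 \<le> norm z \<and> norm z < r * (1/2) ^ k})"
    if r: "0 < r" for r :: real
  proof
    fix z :: 'a assume "z \<in> ball 0 r - {0}"
    then have z: "norm z < r" "z \<noteq> 0" by auto
    define k where "k = (LEAST k. r * (1/2) ^ k / 2 \<le> norm z)"
    obtain k0 where "(1/2) ^ k0 < 2 * norm z / r"
      using real_arch_pow_inv[of "2 * norm z / r" "1/2"] z r by (auto simp: zero_less_divide_iff)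
    then have "r * (1/2) ^ k0 / 2 \<le> norm z" using r by (simp add: field_simps)
    then have k: "r * (1/2) ^ k / 2 \<le> norm z" unfolding k_def by (rule LeastI)
    have "norm z < r * (1/2) ^ k"
    proof (cases k)
      case 0
      then show ?thesis using z by simp
    next
      case (Suc j)
      then have "\<not> r * (1/2) ^ j / 2 \<le> norm z" unfolding k_def by (metis lessI not_less_Least)
      then show ?thesis using Suc by simp
    qed
    with k show "z \<in> (\<Union>k. {z::'a. r * (1/2) ^ k / 2 \<le> norm z \<and> norm z < r * (1/2) ^ k})"
      by auto
  qed
  define f where "f r z = indicator (ball 0 r - {0}) z * norm z powr (2 - N)" for r and z :: 'a
  have eq: "f r (y - x) = indicator (ball x r) y * ((norm (y - x))\<^sup>2 * norm (y - x) powr (- N))" for x y r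
  proof (cases "y = x")
    case False
    then have "(norm (y - x))\<^sup>2 * norm (y - x) powr (- N) = norm (y - x) powr (2 - N)"
      by (simp add: powr_diff powr_minus_divide)
    then show ?thesis using False by (simp add: f_def indicator_def dist_norm norm_minus_commute)
  qed (simp add: f_def)
  have m: "f r \<in> borel_measurable borel" for r
    unfolding f_def by (intro borel_measurable_times borel_measurable_indicator) auto
  note * = integrable_lebesgue_translate[OF m _ _ le[OF _ sub, folded f_def], unfolded eq add_diff_eq]
  show thesis
    by (rule that[OF C]; rule *) (use C in \<open>auto simp: f_def\<close>)
qed

subsection \<open>Admissible matrices\<close>

text \<open>The lower bound is Cauchy-Schwarz. The upper one polarises the quadratic form, with a
  second vector of the length of \<open>x\<close> in the direction of \<open>A *v x\<close>.\<close>

lemma admissible_bounds: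
  fixes A :: "real ^ 'n ^ 'n"
  assumes A: "A \<in> admissible \<theta> \<Theta> e" and "0 < \<theta>"
  shows "\<theta> * norm x \<le> norm (A *v x)" and "norm (A *v x) \<le> \<Theta> * norm x"
proof -
  have sym: "x \<bullet> (A *v y) = (A *v x) \<bullet> y" for x y
  proof -
    have "transpose A = A" using A by (simp add: admissible_def symmetric_matrix_def)
    then show ?thesis using vector_transpose_matrix[of x A] dot_lmul_matrix[of x A y] by simp
  qed
  have scal: "mat k *v x = k *\<^sub>R x" for k :: real and x :: "real ^ 'n"
    by (simp add: vec_eq_iff matrix_vector_mult_def mat_def if_distrib[of "\<lambda>a. a * _"] cong: if_cong)
  have lo: "\<theta> * (x \<bullet> x) \<le> x \<bullet> (A *v x)" and hi: "x \<bullet> (A *v x) \<le> \<Theta> * (x \<bullet> x)" for x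
    using A by (auto simp: admissible_def loewner_le_def matrix_vector_mult_diff_rdistrib
      inner_diff_right scal)
  show "\<theta> * norm x \<le> norm (A *v x)"
  proof (cases "x = 0")
    case False
    have "\<theta> * norm x * norm x \<le> norm (A *v x) * norm x"
      using lo[of x] norm_cauchy_schwarz[of x "A *v x"]
      by (simp add: dot_square_norm power2_eq_square mult.commute mult.left_commute)
    with False show ?thesis by simp
  qed simp
  have nn: "0 \<le> \<Theta>" if "x \<noteq> 0"
  proof -
    have "0 < \<theta> * (x \<bullet> x)" using that \<open>0 < \<theta>\<close> by simp
    also have "\<dots> \<le> \<Theta> * (x \<bullet> x)" using lo[of x] hi[of x] by linarith
    finally show ?thesis by (smt (verit) inner_ge_zero mult_nonpos_nonneg)
  qed
  show "norm (A *v x) \<le> \<Theta> * norm x"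
  proof (cases "A *v x = 0 \<or> x = 0")
    case False
    define y where "y = (norm x / norm (A *v x)) *\<^sub>R (A *v x)"
    have ny: "norm y = norm x" using False by (simp add: y_def)
    have xy: "x \<bullet> (A *v y) = norm x * norm (A *v x)"
      using False by (simp add: sym y_def dot_square_norm power2_eq_square)
    have pos: "0 \<le> (x - y) \<bullet> (A *v (x - y))"
      using lo[of "x - y"] \<open>0 < \<theta>\<close> by (smt (verit) inner_ge_zero mult_nonneg_nonneg)
    \<comment> \<open>In the polarisation identity the subtracted term is nonnegative and drops
      out.\<close>
    have "4 * (x \<bullet> (A *v y)) = (x + y) \<bullet> (A *v (x + y)) - (x - y) \<bullet> (A *v (x - y))"
      using sym[of x y] by (simp add: matrix_vector_right_distrib matrix_vector_mult_diff_distrib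
        inner_add_left inner_add_right inner_diff_left inner_diff_right inner_commute)
    also have "\<dots> \<le> \<Theta> * ((x + y) \<bullet> (x + y))"
      using hi[of "x + y"] pos by linarith
    also have "\<dots> \<le> \<Theta> * (2 * norm x)\<^sup>2"
      unfolding dot_square_norm using norm_triangle_ineq[of x y] ny nn False
      by (intro mult_left_mono power_mono) auto
    finally have "norm x * norm (A *v x) \<le> norm x * (\<Theta> * norm x)"
      unfolding xy by (simp add: power2_eq_square mult.commute mult.left_commute)
    then show ?thesis using False by simp
  next
    case True
    then show ?thesis using nn by (cases "x = 0") auto
  qed
qed

text \<open>The lower bound on \<open>norm (A *v x)\<close> makes \<open>A\<close> injective, hence
  invertible as a square matrix.\<close>

lemma admissible_inverse:
  fixes A :: "real ^ 'n ^ 'n"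
  assumes A: "A \<in> admissible \<theta> \<Theta> e" and "0 < \<theta>"
  shows "A *v (matrix_inv A *v x) = x" and "matrix_inv A *v (A *v x) = x"
proof -
  have "inj ((*v) A)"
  proof (rule injI)
    fix x y assume "A *v x = A *v y"
    then have "A *v (x - y) = 0" by (simp add: matrix_vector_mult_diff_distrib)
    then have "\<theta> * norm (x - y) \<le> 0"
      using admissible_bounds(1)[OF assms, of "x - y"] by simp
    then show "x = y" using \<open>0 < \<theta>\<close> by (simp add: mult_le_0_iff)
  qed
  then have "invertible A"
    using matrix_left_invertible_injective invertible_left_inverse by blast
  then have "A ** matrix_inv A = mat 1 \<and> matrix_inv A ** A = mat 1"
    unfolding invertible_def matrix_inv_def by (rule someI_ex)
  then show "A *v (matrix_inv A *v x) = x" "matrix_inv A *v (A *v x) = x"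
    by (simp_all add: matrix_vector_mul_assoc)
qed

lemma admissible_inverse_bounds:
  fixes A :: "real ^ 'n ^ 'n"
  assumes A: "A \<in> admissible \<theta> \<Theta> e" and "0 < \<theta>" and "\<theta> \<le> \<Theta>"
  shows "norm x / \<Theta> \<le> norm (matrix_inv A *v x)" and "norm (matrix_inv A *v x) \<le> norm x / \<theta>"
proof -
  have "\<theta> * norm (matrix_inv A *v x) \<le> norm x" "norm x \<le> \<Theta> * norm (matrix_inv A *v x)"
    using admissible_bounds[OF assms(1,2), of "matrix_inv A *v x"] admissible_inverse[OF assms(1,2)]
    by simp_all
  then show "norm x / \<Theta> \<le> norm (matrix_inv A *v x)" "norm (matrix_inv A *v x) \<le> norm x / \<theta>"
    using assms(2,3) by (simp_all add: field_simps)
qed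

text \<open>Here the eigenvector condition enters. If \<open>A *v e = k *\<^sub>R e\<close>, then by
  symmetry the inverse multiplies both \<open>e\<close> and the \<open>e\<close>-component of any
  vector by \<open>1 / k\<close>. So the cross term and the square term share the factor
  \<open>l = 1 / k\<^sup>2\<close>, and \<open>\<bar>k\<bar> \<le> \<Theta>\<close> bounds it
  below.\<close>

lemma admissible_inverse_reflect:
  fixes A :: "real ^ 'n ^ 'n"
  assumes A: "A \<in> admissible \<theta> \<Theta> e" and "0 < \<theta>" and "\<theta> \<le> \<Theta>" and e: "norm e = 1"
  obtains l where "(norm (matrix_inv A *v (z + t *\<^sub>R e)))\<^sup>2
      = (norm (matrix_inv A *v z))\<^sup>2 + l * (2 * t * (e \<bullet> z) + t\<^sup>2)"
    and "1 / \<Theta>\<^sup>2 \<le> l"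
proof -
  let ?B = "matrix_inv A"
  obtain k where k: "A *v e = k *\<^sub>R e"
    using A by (auto simp: admissible_def is_eigenvector_def)
  have sym: "x \<bullet> (A *v y) = (A *v x) \<bullet> y" for x y
  proof -
    have "transpose A = A" using A by (simp add: admissible_def symmetric_matrix_def)
    then show ?thesis using vector_transpose_matrix[of x A] dot_lmul_matrix[of x A y] by simp
  qed
  have "\<theta> \<le> \<bar>k\<bar>" "\<bar>k\<bar> \<le> \<Theta>"
    using admissible_bounds[OF A \<open>0 < \<theta>\<close>, of e] e by (simp_all add: k)
  then have k0: "k \<noteq> 0" using \<open>0 < \<theta>\<close> by auto
  have Be: "?B *v e = (1 / k) *\<^sub>R e"
  proof -
    have "e = ?B *v (k *\<^sub>R e)" using admissible_inverse(2)[OF A \<open>0 < \<theta>\<close>, of e] k by simp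
    also have "\<dots> = k *\<^sub>R (?B *v e)" by (simp add: matrix_vector_mult_scaleR)
    finally show ?thesis using k0 by (metis divide_inverse mult_1 scaleR_scaleR left_inverse scaleR_one)
  qed
  have eB: "e \<bullet> (?B *v z) = (1 / k) * (e \<bullet> z)"
  proof -
    have "e \<bullet> z = e \<bullet> (A *v (?B *v z))" using admissible_inverse(1)[OF A \<open>0 < \<theta>\<close>] by simp
    also have "\<dots> = k * (e \<bullet> (?B *v z))" by (simp add: sym k)
    finally show ?thesis using k0 by simp
  qed
  have "?B *v (z + t *\<^sub>R e) = ?B *v z + (t / k) *\<^sub>R e"
    by (simp add: matrix_vector_right_distrib matrix_vector_mult_scaleR Be)
  then have "(norm (?B *v (z + t *\<^sub>R e)))\<^sup>2
      = (norm (?B *v z))\<^sup>2 + 2 * (t / k) * (e \<bullet> (?B *v z)) + (t / k)\<^sup>2 * (e \<bullet> e)"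
    unfolding power2_norm_eq_inner
    by (simp add: inner_add_left inner_add_right inner_commute power2_eq_square)
  then have "(norm (?B *v (z + t *\<^sub>R e)))\<^sup>2 = (norm (?B *v z))\<^sup>2 + (1 / k\<^sup>2) * (2 * t * (e \<bullet> z) + t\<^sup>2)"
    using e k0 unfolding eB by (simp add: norm_eq_1 power2_eq_square field_simps)
  moreover have "1 / \<Theta>\<^sup>2 \<le> 1 / k\<^sup>2"
    using \<open>\<bar>k\<bar> \<le> \<Theta>\<close> k0 by (intro divide_left_mono) (auto simp: abs_le_square_iff[symmetric])
  ultimately show ?thesis by (rule that)
qed

text \<open>A witness that the infimum in \<open>F_op\<close> is taken over a nonempty set.\<close>

lemma scalar_matrix_admissible:
  assumes "\<theta> \<le> \<Theta>" and "e \<noteq> 0"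
  shows "mat \<theta> \<in> admissible \<theta> \<Theta> e"
proof -
  have scal: "mat k *v x = k *\<^sub>R x" for k :: real and x :: "real ^ 'n"
    by (simp add: vec_eq_iff matrix_vector_mult_def mat_def if_distrib[of "\<lambda>a. a * _"] cong: if_cong)
  show ?thesis
    using assms by (auto simp: admissible_def symmetric_matrix_def loewner_le_def is_eigenvector_def
      transpose_mat matrix_vector_mult_diff_rdistrib scal inner_diff_right mult_right_mono)
qed

subsection \<open>Principal values\<close>

lemma borel_measurable_lebesgueI:
  "f \<in> borel_measurable borel \<Longrightarrow> f \<in> borel_measurable lebesgue"
  by (simp add: measurable_completion)

lemma ball_sets_lebesgue [measurable]: "ball x r \<in> sets lebesgue"
  by simp

lemma integral_lebesgue_isometry:
  fixes f :: "'a::euclidean_space \<Rightarrow> real" and R :: "'a \<Rightarrow> 'a"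
  assumes R: "orthogonal_transformation R" and f: "f \<in> borel_measurable lebesgue"
  shows "(LINT x|lebesgue. f (t + R x)) = (LINT x|lebesgue. f x)"
    and "integrable lebesgue (\<lambda>x. f (t + R x)) \<longleftrightarrow> integrable lebesgue f"
proof -
  note T = distr_lebesgue_isometry[OF R, of t]
  show "(LINT x|lebesgue. f (t + R x)) = (LINT x|lebesgue. f x)"
    using integral_distr[OF T(1) f] T(2) by simp
  show "integrable lebesgue (\<lambda>x. f (t + R x)) \<longleftrightarrow> integrable lebesgue f"
    using integrable_distr_eq[OF T(1) f] T(2) by simp
qed

section \<open>Reflections and the folding of integrals across a hyperplane\<close>

lemma reflect_eq: "norm e = 1 \<Longrightarrow> reflect e b x = (2 * b) *\<^sub>R e + (x - (2 * (e \<bullet> x)) *\<^sub>R e)"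
  by (simp add: reflect_def algebra_simps)

lemma orthogonal_transformation_hyperplane:
  fixes e :: "'a::euclidean_space"
  assumes "norm e = 1"
  shows "orthogonal_transformation (\<lambda>x. x - (2 * (e \<bullet> x)) *\<^sub>R e)"
proof -
  have e: "e \<bullet> e = 1" using assms by (simp add: norm_eq_1)
  have "linear (\<lambda>x. x - (2 * (e \<bullet> x)) *\<^sub>R e)"
    by (intro linearI) (simp_all add: algebra_simps inner_add_right)
  then show ?thesis
    using e by (simp add: orthogonal_transformation_def inner_diff_left inner_diff_right inner_commute)
qed

lemma reflect_reflect: "norm e = 1 \<Longrightarrow> reflect e b (reflect e b x) = x"
  by (simp add: reflect_def inner_diff_right algebra_simps norm_eq_1)

lemma inner_reflect: "norm e = 1 \<Longrightarrow> e \<bullet> reflect e b x = 2 * b - e \<bullet> x"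
  by (simp add: reflect_def inner_diff_right norm_eq_1)

text \<open>Reflection preserves integrals, so each side is half the integral of its symmetrised
  integrand. These symmetric functions need comparing on one side only, and the hyperplane is
  null.\<close>

lemma integral_mono_reflect:
  fixes f g :: "real ^ 'n \<Rightarrow> real"
  assumes e: "norm e = 1" and f: "integrable lebesgue f" and g: "integrable lebesgue g"
    and le: "\<And>y. b < e \<bullet> y \<Longrightarrow> f y + f (reflect e b y) \<le> g y + g (reflect e b y)"
  shows "(LINT y|lebesgue. f y) \<le> (LINT y|lebesgue. g y)"
proof -
  note R = orthogonal_transformation_hyperplane[OF e]
  have *: "(LINT y|lebesgue. f (reflect e b y)) = (LINT y|lebesgue. f y)"
    "integrable lebesgue (\<lambda>y. f (reflect e b y))" if "integrable lebesgue f" for f :: "real ^ 'n \<Rightarrow> real"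
    using integral_lebesgue_isometry[OF R, of f "(2 * b) *\<^sub>R e"] that
    by (simp_all add: reflect_eq[OF e])
  have "e \<noteq> 0" using e by auto
  have "AE y in lebesgue. y \<notin> {y. e \<bullet> y = b}"
    using \<open>e \<noteq> 0\<close> negligible_hyperplane[of e b]
    by (intro AE_not_in) (auto simp: negligible_iff_null_sets)
  then have "AE y in lebesgue. f y + f (reflect e b y) \<le> g y + g (reflect e b y)"
  proof eventually_elim
    case (elim y)
    show ?case
    proof (cases "b < e \<bullet> y")
      case False
      then have "b < e \<bullet> reflect e b y" using elim by (simp add: inner_reflect[OF e])
      from le[OF this] show ?thesis by (simp add: reflect_reflect[OF e])
    qed (rule le)
  qed
  then have "(LINT y|lebesgue. f y + f (reflect e b y)) \<le> (LINT y|lebesgue. g y + g (reflect e b y))"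
    using f g by (intro integral_mono_AE Bochner_Integration.integrable_add *)
  then show ?thesis
    using f g by (simp add: *)
qed

text \<open>\<open>N\<close> stands for \<open>n + 2 * s\<close>. The exponent bounds make the
  kernel integrable away from the origin, and near the origin after multiplication by
  \<open>(norm z)\<^sup>2\<close>. Evenness is what cancels the gradient term.\<close>

locale singular_kernel =
  fixes K :: "real ^ 'n \<Rightarrow> real" and N \<Lambda> :: real
  assumes measurable_kernel [measurable]: "K \<in> borel_measurable borel"
    and kernel_even: "K (- z) = K z"
    and kernel_nonneg: "0 \<le> K z"
    and kernel_le: "K z \<le> \<Lambda> * norm z powr (- N)"
    and bound_nonneg: "0 \<le> \<Lambda>"
    and exponent: "real CARD('n) < N" "N < real CARD('n) + 2" "2 \<le> N"
begin

lemma measurable_shifted_kernel [measurable]: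
  "(\<lambda>y. K (y - x)) \<in> borel_measurable lebesgue"
  by (intro borel_measurable_lebesgueI) measurable

lemma measurable_weight [measurable]:
  "(\<lambda>y. norm (y - x) powr (- N)) \<in> borel_measurable lebesgue"
  by (intro borel_measurable_lebesgueI) measurable

lemma measurable_linear_part [measurable]:
  "(\<lambda>y. p \<bullet> (y - x)) \<in> borel_measurable lebesgue" for p x :: "real ^ 'n"
  by (intro borel_measurable_lebesgueI) measurable

lemma integrable_outside_ball:
  fixes x :: "real ^ 'n"
  assumes "0 < r"
  shows "integrable lebesgue (\<lambda>y. indicator (- ball x r) y * norm (y - x) powr (- N))"
  by (rule integral_norm_powr_outside_ball[of N, where 'a="real ^ 'n"]) (use exponent assms in simp_all)

lemma integrable_ball:
  fixes x :: "real ^ 'n"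
  assumes "0 < r"
  shows "integrable lebesgue (\<lambda>y. indicator (ball x r) y * ((norm (y - x))\<^sup>2 * norm (y - x) powr (- N)))"
  by (rule integral_norm_powr_ball[of N, where 'a="real ^ 'n"]) (use exponent assms in simp_all)

lemma integrable_weighted_outside_ball:
  fixes w :: "real ^ 'n \<Rightarrow> real"
  assumes [measurable]: "w \<in> borel_measurable lebesgue"
    and w: "integrable lebesgue (\<lambda>y. \<bar>w y\<bar> / (1 + norm y powr N))" and \<rho>: "0 < \<rho>"
  shows "integrable lebesgue (\<lambda>y. indicator (- ball x \<rho>) y * (\<bar>w y\<bar> * norm (y - x) powr (- N)))"
proof -
  \<comment> \<open>The first summand controls \<open>norm y powr N\<close>, the second controls
    \<open>1\<close>, both in units of \<open>norm (y - x) powr N\<close>.\<close>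
  define C where "C = (1 + norm x / \<rho>) powr N + \<rho> powr (- N)"
  have C: "0 \<le> C" by (simp add: C_def)
  show ?thesis
  proof (rule Bochner_Integration.integrable_bound[where f="\<lambda>y. C * (\<bar>w y\<bar> / (1 + norm y powr N))"])
    show "integrable lebesgue (\<lambda>y. C * (\<bar>w y\<bar> / (1 + norm y powr N)))"
      using w by (rule integrable_mult_right)
    show "(\<lambda>y. indicator (- ball x \<rho>) y * (\<bar>w y\<bar> * norm (y - x) powr (- N))) \<in> borel_measurable lebesgue"
      by measurable
    show "AE y in lebesgue. norm (indicator (- ball x \<rho>) y * (\<bar>w y\<bar> * norm (y - x) powr (- N)))
        \<le> norm (C * (\<bar>w y\<bar> / (1 + norm y powr N)))"
    proof (rule AE_I2)
      fix y :: "real ^ 'n"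
      show "norm (indicator (- ball x \<rho>) y * (\<bar>w y\<bar> * norm (y - x) powr (- N)))
        \<le> norm (C * (\<bar>w y\<bar> / (1 + norm y powr N)))"
      proof (cases "y \<in> ball x \<rho>")
        case False
        define u where "u = norm (y - x)"
        have u: "\<rho> \<le> u" using False by (simp add: u_def dist_norm norm_minus_commute)
        then have u0: "0 < u" using \<rho> by simp
        have "norm y \<le> u + norm x" unfolding u_def using norm_triangle_ineq[of "y - x" x] by simp
        also have "norm x \<le> norm x / \<rho> * u"
          using u \<rho> mult_left_mono[OF u, of "norm x / \<rho>"] by simp
        finally have "norm y \<le> (1 + norm x / \<rho>) * u" by (simp add: algebra_simps)
        then have "norm y powr N \<le> ((1 + norm x / \<rho>) * u) powr N"
          using exponent by (intro powr_mono2) auto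
        also have "\<dots> = (1 + norm x / \<rho>) powr N * u powr N"
          using \<rho> u0 by (simp add: powr_mult)
        finally have 1: "norm y powr N \<le> (1 + norm x / \<rho>) powr N * u powr N" .
        have "1 = \<rho> powr (- N) * \<rho> powr N" using \<rho> by (simp add: powr_minus)
        also have "\<dots> \<le> \<rho> powr (- N) * u powr N"
          using u \<rho> exponent by (intro mult_left_mono powr_mono2) auto
        finally have "1 + norm y powr N \<le> C * u powr N" using 1 by (simp add: C_def algebra_simps)
        then have "u powr (- N) \<le> C / (1 + norm y powr N)"
          using u0 by (simp add: powr_minus field_simps add_pos_nonneg)
        then have "\<bar>w y\<bar> * u powr (- N) \<le> \<bar>w y\<bar> * (C / (1 + norm y powr N))"
          by (intro mult_left_mono) auto
        then show ?thesis using False C by (simp add: u_def[symmetric] abs_mult mult.commute)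
      qed simp
    qed
  qed
qed

section \<open>The principal value as an absolutely convergent integral\<close>

context
  fixes w :: "real ^ 'n \<Rightarrow> real" and x p :: "real ^ 'n" and r \<delta> L :: real
  assumes w_measurable [measurable]: "w \<in> borel_measurable lebesgue"
    and w: "integrable lebesgue (\<lambda>y. \<bar>w y\<bar> / (1 + norm y powr N))"
    and r: "0 < r" and \<delta>: "0 < \<delta>"
    and taylor: "\<And>y. norm (y - x) < \<delta> \<Longrightarrow> \<bar>w y - w x - p \<bullet> (y - x)\<bar> \<le> L * (norm (y - x))\<^sup>2"
begin

text \<open>Near \<open>x\<close> the numerator is quadratic by the Taylor bound, which makes the
  singularity integrable. Away from \<open>x\<close> it is at most \<open>\<bar>w y\<bar>\<close>
  plus a constant, and the growth condition on \<open>w\<close> takes over.\<close>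

lemma integrable_compensated:
  "integrable lebesgue (\<lambda>y. (w y - w x - indicator (ball x r) y * (p \<bullet> (y - x))) * K (y - x))"
    (is "integrable _ ?G")
proof -
  \<comment> \<open>Within the smaller radius the Taylor bound is available and the linear part is
    subtracted.\<close>
  define \<rho> where "\<rho> = min \<delta> r"
  have \<rho>: "0 < \<rho>" "\<rho> \<le> \<delta>" "\<rho> \<le> r" using r \<delta> by (auto simp: \<rho>_def)
  define u where "u y = norm (y - x) powr (- N)" for y
  define H where "H y = \<Lambda> * (L * (indicator (ball x \<rho>) y * ((norm (y - x))\<^sup>2 * u y))
      + indicator (- ball x \<rho>) y * (\<bar>w y\<bar> * u y)
      + (\<bar>w x\<bar> + norm p * r) * (indicator (- ball x \<rho>) y * u y))" for y
  show ?thesis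
  proof (rule Bochner_Integration.integrable_bound[where f=H])
    show "integrable lebesgue H"
      unfolding H_def u_def
      by (intro integrable_mult_right Bochner_Integration.integrable_add integrable_ball
        integrable_outside_ball integrable_weighted_outside_ball w_measurable w \<rho>)
    show "?G \<in> borel_measurable lebesgue"
      by measurable
    show "AE y in lebesgue. norm (?G y) \<le> norm (H y)"
    proof (rule AE_I2)
      fix y
      let ?a = "w y - w x - indicator (ball x r) y * (p \<bullet> (y - x))"
      have K: "\<bar>K (y - x)\<bar> \<le> \<Lambda> * u y" using kernel_le kernel_nonneg by (simp add: u_def)
      have "norm (?G y) \<le> \<bar>?a\<bar> * (\<Lambda> * u y)"
        using mult_left_mono[OF K, of "\<bar>?a\<bar>"] by (simp add: abs_mult)
      also have "\<dots> \<le> H y"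
      proof (cases "y \<in> ball x \<rho>")
        case True
        then have "norm (y - x) < \<delta>" "y \<in> ball x r"
          using \<rho> by (auto simp: dist_norm norm_minus_commute)
        then have "\<bar>?a\<bar> \<le> L * (norm (y - x))\<^sup>2" using taylor by simp
        then have "\<bar>?a\<bar> * (\<Lambda> * u y) \<le> L * (norm (y - x))\<^sup>2 * (\<Lambda> * u y)"
          using bound_nonneg by (intro mult_right_mono) (auto simp: u_def)
        then show ?thesis using True by (simp add: H_def algebra_simps)
      next
        case False
        have "\<bar>p \<bullet> (y - x)\<bar> \<le> norm p * r" if "y \<in> ball x r"
        proof -
          have "norm p * norm (y - x) \<le> norm p * r"
            using that by (intro mult_left_mono) (auto simp: dist_norm norm_minus_commute)
          then show ?thesis using Cauchy_Schwarz_ineq2[of p "y - x"] by linarith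
        qed
        then have "\<bar>indicator (ball x r) y * (p \<bullet> (y - x))\<bar> \<le> norm p * r"
          using r by (auto simp: indicator_def)
        then have "\<bar>?a\<bar> \<le> \<bar>w y\<bar> + (\<bar>w x\<bar> + norm p * r)" by linarith
        then have "\<bar>?a\<bar> * (\<Lambda> * u y) \<le> (\<bar>w y\<bar> + (\<bar>w x\<bar> + norm p * r)) * (\<Lambda> * u y)"
          using bound_nonneg by (intro mult_right_mono) (auto simp: u_def)
        then show ?thesis using False by (simp add: H_def algebra_simps)
      qed
      finally show "norm (?G y) \<le> norm (H y)" by simp
    qed
  qed
qed

text \<open>The subtracted linear part is odd about \<open>x\<close>, so it does not contribute outside any \<open>ball x \<epsilon>\<close>.\<close>

lemma pv_integral_eq_compensated:
  "pv_integral (\<lambda>y. (w y - w x) * K (y - x)) x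
    = (LINT y|lebesgue. (w y - w x - indicator (ball x r) y * (p \<bullet> (y - x))) * K (y - x))"
    (is "pv_integral ?f x = (LINT y|lebesgue. ?G y)")
proof -
  note G = integrable_compensated
  have *: "(LINT y : - ball x \<epsilon> | lebesgue. ?f y) = (LINT y|lebesgue. indicator (- ball x \<epsilon>) y * ?G y)"
    if \<epsilon>: "0 < \<epsilon>" for \<epsilon>
  proof -
    define h where "h y = indicator (- ball x \<epsilon>) y * (indicator (ball x r) y * (p \<bullet> (y - x)) * K (y - x))" for y
    have [measurable]: "h \<in> borel_measurable lebesgue" unfolding h_def by measurable
    have h: "integrable lebesgue h"
    proof (rule Bochner_Integration.integrable_bound
        [where f="\<lambda>y. norm p * r * \<Lambda> * (indicator (- ball x \<epsilon>) y * norm (y - x) powr (- N))"])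
      show "integrable lebesgue (\<lambda>y. norm p * r * \<Lambda> * (indicator (- ball x \<epsilon>) y * norm (y - x) powr (- N)))"
        by (intro integrable_mult_right integrable_outside_ball \<epsilon>)
      show "AE y in lebesgue. norm (h y)
          \<le> norm (norm p * r * \<Lambda> * (indicator (- ball x \<epsilon>) y * norm (y - x) powr (- N)))"
      proof (rule AE_I2)
        fix y
        have "\<bar>p \<bullet> (y - x)\<bar> * \<bar>K (y - x)\<bar> \<le> (norm p * r) * (\<Lambda> * norm (y - x) powr (- N))"
          if "y \<in> ball x r"
        proof (rule mult_mono)
          have "norm p * norm (y - x) \<le> norm p * r"
            using that by (intro mult_left_mono) (auto simp: dist_norm norm_minus_commute)
          then show "\<bar>p \<bullet> (y - x)\<bar> \<le> norm p * r" using Cauchy_Schwarz_ineq2[of p "y - x"] by linarith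
        qed (use kernel_le kernel_nonneg r in auto)
        then show "norm (h y) \<le> norm (norm p * r * \<Lambda> * (indicator (- ball x \<epsilon>) y * norm (y - x) powr (- N)))"
          using r bound_nonneg by (auto simp: h_def indicator_def abs_mult mult.assoc)
      qed
    qed measurable
    \<comment> \<open>Under the point reflection about \<open>x\<close> the kernel and both
      indicators are invariant while the linear factor changes sign, so the integral of
      \<open>h\<close> vanishes.\<close>
    have "h (2 *\<^sub>R x + - y) = - h y" for y
    proof -
      have e: "2 *\<^sub>R x + - y - x = - (y - x)" by (simp add: scaleR_2)
      have d: "dist x (2 *\<^sub>R x + - y) = dist x y"
        by (metis dist_commute dist_norm e norm_minus_cancel)
      have i: "indicator (ball x \<rho>) (2 *\<^sub>R x + - y) = (indicator (ball x \<rho>) y :: real)"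
        "indicator (- ball x \<rho>) (2 *\<^sub>R x + - y) = (indicator (- ball x \<rho>) y :: real)" for \<rho>
        by (simp_all only: indicator_def mem_ball Compl_iff d)
      show ?thesis
        unfolding h_def e kernel_even i inner_minus_right by simp
    qed
    then have "(LINT y|lebesgue. h y) = - (LINT y|lebesgue. h y)"
      using integral_lebesgue_isometry(1)[of uminus h "2 *\<^sub>R x"]
      by (simp add: orthogonal_transformation_neg)
    then have "(LINT y|lebesgue. h y) = 0" by simp
    moreover have "(LINT y : - ball x \<epsilon> | lebesgue. ?f y)
        = (LINT y|lebesgue. indicator (- ball x \<epsilon>) y * ?G y + h y)"
      unfolding set_lebesgue_integral_def
      by (intro Bochner_Integration.integral_cong) (auto simp: h_def algebra_simps)
    moreover have "integrable lebesgue (\<lambda>y. indicator (- ball x \<epsilon>) y * ?G y)"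
      using integrable_mult_indicator[OF _ G, of "- ball x \<epsilon>"] by simp
    ultimately show ?thesis using h by simp
  qed
  \<comment> \<open>Dominated convergence in the variable \<open>t = 1 / \<epsilon>\<close>. For
    \<open>y\<close> other than \<open>x\<close> the integrand is eventually constant; at
    \<open>y = x\<close> it is zero.\<close>
  have "((\<lambda>t. LINT y|lebesgue. indicator (- ball x (inverse t)) y * ?G y) \<longlongrightarrow> (LINT y|lebesgue. ?G y)) at_top"
  proof (rule integral_dominated_convergence_at_top[where w="\<lambda>y. norm (?G y)"])
    show "?G \<in> borel_measurable lebesgue" using G by (rule borel_measurable_integrable)
    then show "(\<lambda>y. indicator (- ball x (inverse t)) y * ?G y) \<in> borel_measurable lebesgue" for t
      by (intro borel_measurable_times borel_measurable_indicator) auto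
    show "integrable lebesgue (\<lambda>y. norm (?G y))" using G by (rule integrable_norm)
    show "\<forall>\<^sub>F t in at_top. AE y in lebesgue. norm (indicator (- ball x (inverse t)) y * ?G y) \<le> norm (?G y)"
      by (intro always_eventually allI AE_I2) (simp add: indicator_def)
    show "AE y in lebesgue. ((\<lambda>t. indicator (- ball x (inverse t)) y * ?G y) \<longlongrightarrow> ?G y) at_top"
    proof (rule AE_I2)
      fix y
      show "((\<lambda>t. indicator (- ball x (inverse t)) y * ?G y) \<longlongrightarrow> ?G y) at_top"
      proof (cases "y = x")
        case False
        have "\<forall>\<^sub>F t in at_top. inverse t < dist x y"
          using order_tendstoD(2)[OF tendsto_inverse_0_at_top[OF filterlim_ident], of "dist x y"] False
          by simp
        then have "\<forall>\<^sub>F t in at_top. indicator (- ball x (inverse t)) y * ?G y = ?G y"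
          by eventually_elim simp
        then show ?thesis by (rule tendsto_eventually)
      qed simp
    qed
  qed
  then have "((\<lambda>\<epsilon>. LINT y|lebesgue. indicator (- ball x \<epsilon>) y * ?G y) \<longlongrightarrow> (LINT y|lebesgue. ?G y)) (at_right 0)"
    by (simp add: filterlim_at_right_to_top)
  moreover have "\<forall>\<^sub>F \<epsilon> in at_right 0. (LINT y|lebesgue. indicator (- ball x \<epsilon>) y * ?G y)
      = (LINT y : - ball x \<epsilon> | lebesgue. ?f y)"
    using * by (intro eventually_at_rightI[of 0 1]) auto
  ultimately have "((\<lambda>\<epsilon>. LINT y : - ball x \<epsilon> | lebesgue. ?f y) \<longlongrightarrow> (LINT y|lebesgue. ?G y)) (at_right 0)"
    by (rule Lim_transform_eventually)
  then show ?thesis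
    unfolding pv_integral_def by (intro tendsto_Lim) auto
qed

end

end

subsection \<open>The kernel of an admissible matrix\<close>

text \<open>The value at \<open>0\<close> is the junk value \<open>0\<close>, like that of the quotient in \<^const>\<open>F_op\<close>.\<close>

definition inverse_kernel :: "real \<Rightarrow> real ^ 'n ^ 'n \<Rightarrow> real ^ 'n \<Rightarrow> real" where
  "inverse_kernel N A z = norm (matrix_inv A *v z) powr (- N)"

text \<open>Negative powers reverse the bounds for the inverse matrix; at \<open>z = 0\<close> all
  terms are \<open>0\<close> by the convention for \<open>powr\<close>.\<close>

lemma inverse_kernel_bounds:
  assumes A: "A \<in> admissible \<theta> \<Theta> e" and "0 < \<theta>" and "\<theta> \<le> \<Theta>" and "0 \<le> N"
  shows "inverse_kernel N A z \<le> \<Theta> powr N * norm z powr (- N)"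
    and "\<theta> powr N * norm z powr (- N) \<le> inverse_kernel N A z"
proof -
  note B = admissible_inverse_bounds[OF assms(1-3), of z]
  have "inverse_kernel N A z \<le> \<Theta> powr N * norm z powr (- N) \<and>
      \<theta> powr N * norm z powr (- N) \<le> inverse_kernel N A z"
  proof (cases "z = 0")
    case False
    have pos: "0 < norm z / \<Theta>" "0 < norm z / \<theta>" using False assms by auto
    then have pos': "0 < norm (matrix_inv A *v z)" using B(1) by linarith
    have "inverse_kernel N A z \<le> (norm z / \<Theta>) powr (- N)" "(norm z / \<theta>) powr (- N) \<le> inverse_kernel N A z"
      unfolding inverse_kernel_def using B pos pos' \<open>0 \<le> N\<close> by (auto intro!: powr_mono2')
    moreover have "(norm z / k) powr (- N) = k powr N * norm z powr (- N)" if "0 < k" for k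
      using that False by (simp add: powr_divide powr_minus divide_simps)
    ultimately show ?thesis using assms by auto
  qed (simp add: inverse_kernel_def)
  then show "inverse_kernel N A z \<le> \<Theta> powr N * norm z powr (- N)"
    "\<theta> powr N * norm z powr (- N) \<le> inverse_kernel N A z" by auto
qed

lemma singular_kernel_inverse_kernel:
  fixes A :: "real ^ 'n ^ 'n"
  assumes "A \<in> admissible \<theta> \<Theta> e" and "0 < \<theta>" and "\<theta> \<le> \<Theta>"
    and "real CARD('n) < N" "N < real CARD('n) + 2" "2 \<le> N"
  shows "singular_kernel (inverse_kernel N A) N (\<Theta> powr N)"
proof
  have "(\<lambda>z. matrix_inv A *v z) \<in> borel_measurable borel"
    by (intro borel_measurable_continuous_onI continuous_intros matrix_vector_mult_linear_continuous_on)
  then show "inverse_kernel N A \<in> borel_measurable borel"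
    unfolding inverse_kernel_def by measurable
  show "inverse_kernel N A (- z) = inverse_kernel N A z" for z
    using matrix_vector_mult_diff_distrib[of "matrix_inv A" 0 z] by (simp add: inverse_kernel_def)
  show "inverse_kernel N A z \<le> \<Theta> powr N * norm z powr (- N)" for z
    using inverse_kernel_bounds[OF assms(1-3)] assms by simp
qed (use assms in \<open>simp_all add: inverse_kernel_def\<close>)

text \<open>The reflection moves \<open>y\<close> along \<open>e\<close> by
  \<open>t = - 2 * (e \<bullet> y - b)\<close>, and then
  \<open>2 * t * (e \<bullet> (y - x)) + t\<^sup>2\<close> collapses to four times the product of
  the signed distances of \<open>x\<close> and \<open>y\<close> to the hyperplane.\<close>

lemma norm_inverse_reflect:
  fixes A :: "real ^ 'n ^ 'n"
  assumes "A \<in> admissible \<theta> \<Theta> e" and "0 < \<theta>" and "\<theta> \<le> \<Theta>" and "norm e = 1"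
  obtains l where "1 / \<Theta>\<^sup>2 \<le> l"
    and "(norm (matrix_inv A *v (reflect e b y - x)))\<^sup>2
      = (norm (matrix_inv A *v (y - x)))\<^sup>2 + 4 * l * (e \<bullet> x - b) * (e \<bullet> y - b)"
proof -
  obtain l where l: "(norm (matrix_inv A *v ((y - x) + (- (2 * (e \<bullet> y - b))) *\<^sub>R e)))\<^sup>2
      = (norm (matrix_inv A *v (y - x)))\<^sup>2
        + l * (2 * (- (2 * (e \<bullet> y - b))) * (e \<bullet> (y - x)) + (- (2 * (e \<bullet> y - b)))\<^sup>2)"
    and "1 / \<Theta>\<^sup>2 \<le> l"
    using admissible_inverse_reflect[OF assms] by blast
  have "(y - x) + (- (2 * (e \<bullet> y - b))) *\<^sub>R e = reflect e b y - x"
    by (simp add: reflect_def del: minus_diff_eq)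
  moreover have "l * (2 * (- (2 * (e \<bullet> y - b))) * (e \<bullet> (y - x)) + (- (2 * (e \<bullet> y - b)))\<^sup>2)
      = 4 * l * (e \<bullet> x - b) * (e \<bullet> y - b)"
    by (simp add: inner_diff_right power2_eq_square algebra_simps)
  ultimately show ?thesis using l that[OF \<open>1 / \<Theta>\<^sup>2 \<le> l\<close>] by (simp only:)
qed

text \<open>The difference factors as \<open>u powr (- c) * (1 - (u / (u + a)) powr c)\<close>. Both
  factors are nonnegative and nonincreasing in \<open>u\<close>, and the second is nondecreasing in
  \<open>a\<close>, so the worst case is at \<open>U\<close> and \<open>a0\<close>.\<close>

lemma powr_minus_gap:
  fixes u U a a0 c :: real
  assumes "0 < u" "u \<le> U" "0 \<le> a0" "a0 \<le> a" "0 \<le> c"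
  shows "U powr (- c) * (1 - (U / (U + a0)) powr c) \<le> u powr (- c) - (u + a) powr (- c)"
proof -
  have "(u + a) powr (- c) = u powr (- c) * (u / (u + a)) powr c"
    using assms by (simp add: powr_divide powr_minus divide_simps)
  moreover have "u / (u + a) \<le> U / (U + a0)"
  proof -
    have "u * a0 \<le> U * a" using assms by (intro mult_mono) auto
    then show ?thesis using assms by (simp add: divide_simps algebra_simps)
  qed
  then have "(u / (u + a)) powr c \<le> (U / (U + a0)) powr c"
    using assms by (intro powr_mono2) auto
  moreover have "U powr (- c) \<le> u powr (- c)"
    using assms by (intro powr_mono2') auto
  moreover have "(U / (U + a0)) powr c \<le> 1"
    using assms by (intro powr_le1) (auto simp: divide_simps)
  ultimately have "U powr (- c) * (1 - (U / (U + a0)) powr c) \<le> u powr (- c) * (1 - (u / (u + a)) powr c)"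
    by (intro mult_mono) auto
  then show ?thesis using \<open>(u + a) powr (- c) = _\<close> by (simp add: algebra_simps)
qed

text \<open>This is \<open>powr_minus_gap\<close> for the squared norms of the transformed vectors,
  with exponent \<open>N / 2\<close>. Only \<open>\<theta>\<close>, \<open>\<Theta>\<close>,
  \<open>R\<close> and \<open>h\<close> enter \<open>U\<close> and \<open>a\<close>, so the gap is
  uniform over admissible matrices.\<close>

lemma inverse_kernel_reflect_gap:
  fixes A :: "real ^ 'n ^ 'n"
  assumes A: "A \<in> admissible \<theta> \<Theta> e" "0 < \<theta>" "\<theta> \<le> \<Theta>" "norm e = 1" and "0 \<le> N"
    and "y \<noteq> x" and "norm (y - x) \<le> R"
    and "0 \<le> h" "h \<le> (e \<bullet> x - b) * (e \<bullet> y - b)"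
  defines "U \<equiv> (R / \<theta>)\<^sup>2" and "a \<equiv> 4 / \<Theta>\<^sup>2 * h"
  shows "U powr (- (N / 2)) * (1 - (U / (U + a)) powr (N / 2))
      \<le> inverse_kernel N A (y - x) - inverse_kernel N A (reflect e b y - x)"
proof -
  obtain l where l: "1 / \<Theta>\<^sup>2 \<le> l"
    "(norm (matrix_inv A *v (reflect e b y - x)))\<^sup>2
      = (norm (matrix_inv A *v (y - x)))\<^sup>2 + 4 * l * (e \<bullet> x - b) * (e \<bullet> y - b)"
    using norm_inverse_reflect[OF A] by blast
  let ?u = "(norm (matrix_inv A *v (y - x)))\<^sup>2" and ?a = "4 * l * ((e \<bullet> x - b) * (e \<bullet> y - b))"
  note B = admissible_inverse_bounds[OF A(1-3), of "y - x"]
  have "0 < norm (y - x) / \<Theta>" using assms by auto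
  then have pos: "0 < norm (matrix_inv A *v (y - x))" using B(1) by linarith
  have u: "?u \<le> U"
  proof -
    have "norm (y - x) / \<theta> \<le> R / \<theta>" using assms(2,7) by (intro divide_right_mono) auto
    with B(2) show ?thesis unfolding U_def by (intro power_mono) auto
  qed
  have "4 * (1 / \<Theta>\<^sup>2) * h \<le> ?a"
    using l assms by (intro mult_mono) (auto intro: order_trans[rotated])
  then have a: "a \<le> ?a" "0 \<le> a" using \<open>0 \<le> h\<close> by (simp_all add: a_def)
  have k: "norm v powr (- N) = (norm v)\<^sup>2 powr (- (N / 2))" if "0 < norm v" for v :: "real ^ 'n"
    using that by (simp add: powr_powr flip: powr_numeral)
  have pos': "0 < norm (matrix_inv A *v (reflect e b y - x))"
  proof -
    have "0 < ?u" using pos by simp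
    also have "?u \<le> (norm (matrix_inv A *v (reflect e b y - x)))\<^sup>2"
      using l(2) a by (simp add: mult.assoc)
    finally show ?thesis by (simp add: zero_less_power2)
  qed
  show ?thesis
    unfolding inverse_kernel_def k[OF pos] k[OF pos'] l(2)
    using powr_minus_gap[of ?u U a ?a "N / 2"] u a pos \<open>0 \<le> N\<close> by (simp add: mult.assoc)
qed

text \<open>The case \<open>h = 0\<close> of the gap. The point \<open>y = x\<close> is excluded
  because the kernel has the value \<open>0\<close> at the origin.\<close>

lemma inverse_kernel_reflect_le:
  fixes A :: "real ^ 'n ^ 'n"
  assumes A: "A \<in> admissible \<theta> \<Theta> e" "0 < \<theta>" "\<theta> \<le> \<Theta>" "norm e = 1" and "0 \<le> N"
    and "y \<noteq> x" and "b < e \<bullet> x" "b < e \<bullet> y"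
  shows "inverse_kernel N A (reflect e b y - x) \<le> inverse_kernel N A (y - x)"
  using inverse_kernel_reflect_gap[OF A \<open>0 \<le> N\<close> \<open>y \<noteq> x\<close> order_refl, of 0 b] assms
  by simp

section \<open>Quadratic Taylor bound and critical points\<close>

text \<open>By the mean value inequality for \<open>w\<close> minus its linearisation: on the closed
  ball of radius \<open>norm (y - x)\<close> the gradient differs from \<open>g x\<close> by at most
  \<open>L * norm (y - x)\<close>.\<close>

lemma C11_loc_taylor:
  fixes w :: "'a::euclidean_space \<Rightarrow> real"
  assumes "w \<in> C11_loc U" and "open U"
  obtains g where "\<And>x. x \<in> U \<Longrightarrow> GDERIV w x :> g x"
    and "\<And>x. x \<in> U \<Longrightarrow> \<exists>\<delta>>0. \<exists>L. \<forall>y. norm (y - x) < \<delta> \<longrightarrow>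
      \<bar>w y - w x - g x \<bullet> (y - x)\<bar> \<le> L * (norm (y - x))\<^sup>2"
proof -
  obtain g where g: "\<And>x. x \<in> U \<Longrightarrow> GDERIV w x :> g x"
    and lip: "\<And>x. x \<in> U \<Longrightarrow> \<exists>r>0. \<exists>L. L-lipschitz_on (ball x r \<inter> U) g"
    using assms(1) unfolding C11_loc_def by blast
  show thesis
  proof (rule that[of g])
    fix x assume x: "x \<in> U"
    obtain r L where r: "0 < r" and L: "L-lipschitz_on (ball x r \<inter> U) g" using lip[OF x] by blast
    obtain r' where r': "0 < r'" "ball x r' \<subseteq> U" using assms(2) x openE by blast
    define \<delta> where "\<delta> = min r r'"
    have \<delta>: "0 < \<delta>" "ball x \<delta> \<subseteq> ball x r \<inter> U" using r r' by (auto simp: \<delta>_def)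
    have "\<bar>w y - w x - g x \<bullet> (y - x)\<bar> \<le> L * (norm (y - x))\<^sup>2" if y: "norm (y - x) < \<delta>" for y
    proof -
      have sub: "cball x (norm (y - x)) \<subseteq> ball x \<delta>" using y by auto
      have "norm (w y - w x - (y - x) \<bullet> g x) \<le> norm (y - x) * (L * norm (y - x))"
      proof (rule differentiable_bound_linearization[where S="cball x (norm (y - x))"
            and f'="\<lambda>\<xi> h. h \<bullet> g \<xi>"])
        show "x + t *\<^sub>R (y - x) \<in> cball x (norm (y - x))" if "t \<in> {0..1}" for t
          using that by (simp add: dist_norm mult_left_le_one_le)
        show "(w has_derivative (\<lambda>h. h \<bullet> g \<xi>)) (at \<xi> within cball x (norm (y - x)))"
          if "\<xi> \<in> cball x (norm (y - x))" for \<xi>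
          using g[of \<xi>] that sub \<delta> unfolding gderiv_def by (blast intro: has_derivative_at_withinI)
        show "onorm ((\<lambda>h. h \<bullet> g \<xi>) - (\<lambda>h. h \<bullet> g x)) \<le> L * norm (y - x)"
          if \<xi>: "\<xi> \<in> cball x (norm (y - x))" for \<xi>
        proof (rule onorm_le)
          fix h :: 'a
          have "norm (g \<xi> - g x) \<le> L * norm (\<xi> - x)"
          proof (rule lipschitz_on_normD[OF L])
            show "\<xi> \<in> ball x r \<inter> U" using \<xi> sub \<delta> by blast
          qed (use x r in simp)
          also have "\<dots> \<le> L * norm (y - x)"
            using \<xi> lipschitz_on_nonneg[OF L]
            by (intro mult_left_mono) (auto simp: dist_norm norm_minus_commute)
          finally have "norm h * norm (g \<xi> - g x) \<le> norm h * (L * norm (y - x))"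
            by (intro mult_left_mono) auto
          then show "norm (((\<lambda>h. h \<bullet> g \<xi>) - (\<lambda>h. h \<bullet> g x)) h) \<le> L * norm (y - x) * norm h"
            using Cauchy_Schwarz_ineq2[of h "g \<xi> - g x"]
            by (simp add: inner_diff_right mult.commute)
        qed
      qed simp
      then show ?thesis by (simp add: inner_commute power2_eq_square mult.left_commute)
    qed
    then show "\<exists>\<delta>>0. \<exists>L. \<forall>y. norm (y - x) < \<delta> \<longrightarrow>
      \<bar>w y - w x - g x \<bullet> (y - x)\<bar> \<le> L * (norm (y - x))\<^sup>2"
      using \<delta> by blast
  qed (rule g)
qed

lemma GDERIV_critical_point:
  assumes "GDERIV f x :> p" and "open S" "x \<in> S" and "\<And>y. y \<in> S \<Longrightarrow> f x \<le> f y"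
  shows "p = 0"
proof -
  have "(\<lambda>h. h \<bullet> p) = (\<lambda>h. 0)"
    using assms by (intro differential_zero_maxmin[of x S f]) (auto simp: gderiv_def)
  then show ?thesis by (metis inner_eq_zero_iff)
qed

subsection \<open>The maximum principle\<close>

text \<open>A lower bound uniform in the matrix passes to the infimum over a nonempty set. The
  quotient in \<open>F_op\<close> becomes a product with \<open>inverse_kernel\<close>.\<close>

lemma F_op_ge:
  assumes "\<theta> \<le> \<Theta>" and "e \<noteq> 0" and "N = real CARD('n) + 2 * s"
    and "\<And>A. A \<in> admissible \<theta> \<Theta> e \<Longrightarrow>
      k \<le> pv_integral (\<lambda>y. (u y - u x) * inverse_kernel N A (y - x)) x"
  shows "k \<le> F_op s \<theta> \<Theta> e u (x :: real ^ 'n)"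
  unfolding F_op_def
proof (rule cINF_greatest)
  show "admissible \<theta> \<Theta> e \<noteq> {}" using scalar_matrix_admissible assms by blast
  show "k \<le> pv_integral (\<lambda>y. (u y - u x) / norm (matrix_inv A *v (y - x)) powr (real CARD('n) + 2 * s)) x"
    if "A \<in> admissible \<theta> \<Theta> e" for A
    using assms(4)[OF that] unfolding inverse_kernel_def powr_minus divide_inverse assms(3) .
qed

context
  fixes s \<theta> \<Theta> b N :: real and e :: "real ^ 'n" and w :: "real ^ 'n \<Rightarrow> real" and \<Sigma> :: "(real ^ 'n) set"
  assumes n: "CARD('n) \<ge> 2" and s: "0 < s" "s < 1" and \<theta>: "0 < \<theta>" "\<theta> \<le> \<Theta>" and e: "norm e = 1"
    and N: "N = real CARD('n) + 2 * s"
    and \<Sigma>: "\<Sigma> = {x. b < e \<bullet> x}"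
    and w: "w \<in> L_space s"
    and odd: "\<And>x. x \<in> \<Sigma> \<Longrightarrow> w (reflect e b x) = - w x"
begin

lemma exponent_bounds: "real CARD('n) < N" "N < real CARD('n) + 2" "2 \<le> N" "0 \<le> N" "0 < N"
  using n s by (auto simp: N)

text \<open>Reduces lower bounds to a pointwise comparison on \<open>\<Sigma>\<close>: the
  compensated integrand at \<open>y\<close> is paired with that at the reflected point, where
  oddness replaces \<open>w\<close> by \<open>- w y\<close>.\<close>

lemma pv_integral_ge:
  fixes x p :: "real ^ 'n"
  assumes A: "A \<in> admissible \<theta> \<Theta> e" and r: "0 < r" and \<delta>: "0 < \<delta>"
    and taylor: "\<And>y. norm (y - x) < \<delta> \<Longrightarrow> \<bar>w y - w x - p \<bullet> (y - x)\<bar> \<le> L * (norm (y - x))\<^sup>2"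
    and l: "integrable lebesgue l"
    and le: "\<And>y. y \<in> \<Sigma> \<Longrightarrow> l y + l (reflect e b y) \<le>
      (w y - w x - indicator (ball x r) y * (p \<bullet> (y - x))) * inverse_kernel N A (y - x)
      + (- w y - w x - indicator (ball x r) (reflect e b y) * (p \<bullet> (reflect e b y - x)))
        * inverse_kernel N A (reflect e b y - x)"
  shows "(LINT y|lebesgue. l y) \<le> pv_integral (\<lambda>y. (w y - w x) * inverse_kernel N A (y - x)) x"
proof -
  interpret singular_kernel "inverse_kernel N A" N "\<Theta> powr N"
    using A \<theta> exponent_bounds by (intro singular_kernel_inverse_kernel)
  have w': "w \<in> borel_measurable lebesgue" "integrable lebesgue (\<lambda>y. \<bar>w y\<bar> / (1 + norm y powr N))"
    using w by (simp_all add: L_space_def N)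
  have eq: "pv_integral (\<lambda>y. (w y - w x) * inverse_kernel N A (y - x)) x = (LINT y|lebesgue.
      (w y - w x - indicator (ball x r) y * (p \<bullet> (y - x))) * inverse_kernel N A (y - x))"
    by (rule pv_integral_eq_compensated[OF w' r \<delta> taylor])
  show ?thesis
    unfolding eq using le odd by (intro integral_mono_reflect[OF e l integrable_compensated[OF w' r \<delta> taylor], of b])
      (auto simp: \<Sigma>)
qed

text \<open>Both sides scale like \<open>r\<close> to the power \<open>- 2 * s\<close>, so the size of \<open>\<epsilon>\<close> needed for positivity
  does not depend on \<open>r\<close>, that is, on the distance of \<open>x\<close> to the hyperplane.\<close>

lemma pv_integral_ge_near_infimum:
  fixes x p :: "real ^ 'n"
  assumes A: "A \<in> admissible \<theta> \<Theta> e" and r: "0 < r" and \<delta>: "0 < \<delta>"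
    and taylor: "\<And>y. norm (y - x) < \<delta> \<Longrightarrow> \<bar>w y - w x - p \<bullet> (y - x)\<bar> \<le> L * (norm (y - x))\<^sup>2"
    and ball: "ball x r \<subseteq> \<Sigma>" and far: "e \<bullet> x - b \<le> 3 * r"
    and \<epsilon>: "0 < \<epsilon>" "6 * \<epsilon> \<le> m"
    and inf: "\<And>y. y \<in> \<Sigma> \<Longrightarrow> - m \<le> w y" and wx: "w x \<le> - m + \<epsilon>"
    and p: "norm p \<le> 4 * \<epsilon> / r"
    and touch: "\<And>y. y \<in> ball x r \<Longrightarrow> p \<bullet> (y - x) - 2 * \<epsilon> / r\<^sup>2 * (norm (y - x))\<^sup>2 \<le> w y - w x"
    and C1: "\<And>r (x :: real ^ 'n). 0 < r \<Longrightarrow>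
      (LINT y|lebesgue. indicator (ball x r) y * ((norm (y - x))\<^sup>2 * norm (y - x) powr (- N)))
        \<le> C1 * r powr (real CARD('n) + 2 - N)"
    and C2: "\<And>r (x :: real ^ 'n). 0 < r \<Longrightarrow>
      (LINT y|lebesgue. indicator (- ball x r) y * norm (y - x) powr (- N)) \<le> C2 * r powr (real CARD('n) - N)"
  shows "r powr (- 2 * s) * (m * \<theta> powr N * 7 powr (- N) * unit_ball_vol (real CARD('n)) - \<epsilon> * \<Theta> powr N * (2 * C1 + C2))
    \<le> pv_integral (\<lambda>y. (w y - w x) * inverse_kernel N A (y - x)) x"
proof -
  interpret singular_kernel "inverse_kernel N A" N "\<Theta> powr N"
    using A \<theta> exponent_bounds by (intro singular_kernel_inverse_kernel)
  let ?K = "inverse_kernel N A" and ?\<rho> = "reflect e b"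
  define q where "q = 2 * \<epsilon> / r\<^sup>2"
  have q: "0 \<le> q" using \<epsilon> by (simp add: q_def)
  \<comment> \<open>A lower bound for the kernel at the reflections of points of
    \<open>ball x r\<close>, which lie within \<open>7 * r\<close> of \<open>x\<close>.\<close>
  define c where "c = \<theta> powr N * (7 * r) powr (- N)"
  have c: "0 \<le> c" by (simp add: c_def)
  define f1 where "f1 y = indicator (ball x r) y * ((norm (y - x))\<^sup>2 * norm (y - x) powr (- N))" for y
  define f2 where "f2 y = indicator (- ball x r) y * norm (y - x) powr (- N)" for y
  define f3 where "f3 y = (indicator (ball (?\<rho> x) r) y :: real)" for y
  have f: "integrable lebesgue f1" "integrable lebesgue f2"
    unfolding f1_def f2_def by (intro integrable_ball integrable_outside_ball r)+
  have f3: "integrable lebesgue f3" 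
    by (simp add: f3_def[abs_def] flip: lmeasurable_iff_integrable)
  have f3_int: "(LINT y|lebesgue. f3 y) = unit_ball_vol (real CARD('n)) * r powr real CARD('n)"
    using r by (simp add: f3_def[abs_def] content_ball powr_realpow)
  \<comment> \<open>Two losses and a gain: the touching paraboloid with coefficient \<open>q\<close>
    inside the ball, \<open>w y - w x \<ge> - \<epsilon>\<close> outside it, and the reflected
    kernel. The gain sits on the reflected ball, so folding counts it once, at the points of
    \<open>ball x r\<close>.\<close>
  define l where "l y = - (q * \<Theta> powr N) * f1 y - \<epsilon> * \<Theta> powr N * f2 y + m * c * f3 y" for y
  have l: "integrable lebesgue l"
    unfolding l_def using f f3 by simp
  have "r powr (- 2 * s) * (m * \<theta> powr N * 7 powr (- N) * unit_ball_vol (real CARD('n)) - \<epsilon> * \<Theta> powr N * (2 * C1 + C2))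
      = - (q * \<Theta> powr N) * (C1 * r powr (real CARD('n) + 2 - N))
        - \<epsilon> * \<Theta> powr N * (C2 * r powr (real CARD('n) - N))
        + m * c * (unit_ball_vol (real CARD('n)) * r powr real CARD('n))"
  proof -
    have alg: "X * (m * T * k * v - \<epsilon> * H * (2 * C1 + C2))
        = - (q * H) * (C1 * (R * X)) - \<epsilon> * H * (C2 * X) + m * (T * (k * X')) * (v * Y)"
      if "q * R = 2 * \<epsilon>" "X' * Y = X" for X X' Y T k v H R :: real
      using that by algebra
    have *: "r powr (real CARD('n) + 2 - N) = r\<^sup>2 * r powr (- 2 * s)"
      using r by (simp add: N powr_add[symmetric] flip: powr_numeral)
    have **: "r powr (real CARD('n) - N) = r powr (- 2 * s)" by (simp add: N)
    have ***: "(7 * r) powr (- N) = 7 powr (- N) * r powr (- N)"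
      using r by (simp add: powr_mult)
    show ?thesis
      unfolding c_def * ** ***
    proof (rule alg)
      show "q * r\<^sup>2 = 2 * \<epsilon>" using r by (simp add: q_def)
      show "r powr (- N) * r powr real CARD('n) = r powr (- 2 * s)"
        using r by (simp add: N flip: powr_add)
    qed
  qed
  also have "\<dots> \<le> - (q * \<Theta> powr N) * (LINT y|lebesgue. f1 y) - \<epsilon> * \<Theta> powr N * (LINT y|lebesgue. f2 y)
      + m * c * (LINT y|lebesgue. f3 y)"
  proof -
    have "q * \<Theta> powr N * (LINT y|lebesgue. f1 y) \<le> q * \<Theta> powr N * (C1 * r powr (real CARD('n) + 2 - N))"
      using C1[OF r, of x, folded f1_def] q by (intro mult_left_mono) auto
    moreover have "\<epsilon> * \<Theta> powr N * (LINT y|lebesgue. f2 y) \<le> \<epsilon> * \<Theta> powr N * (C2 * r powr (real CARD('n) - N))"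
      using C2[OF r, of x, folded f2_def] \<epsilon> by (intro mult_left_mono) auto
    ultimately show ?thesis unfolding f3_int mult_minus_left by linarith
  qed
  also have "\<dots> = (LINT y|lebesgue. l y)"
    unfolding l_def using f f3 by simp
  also have "\<dots> \<le> pv_integral (\<lambda>y. (w y - w x) * ?K (y - x)) x"
  proof (rule pv_integral_ge[OF A r \<delta> taylor l])
    fix y assume y: "y \<in> \<Sigma>"
    let ?z = "?\<rho> y - x"
    have x: "x \<in> \<Sigma>" using ball r by auto
    have \<rho>y: "?\<rho> y \<notin> \<Sigma>" using y by (simp add: \<Sigma> inner_reflect[OF e])
    have \<rho>y_ball: "?\<rho> y \<notin> ball x r" using ball \<rho>y by blast
    have iso: "dist (?\<rho> u) (?\<rho> v) = dist u v" for u v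
    proof -
      have "?\<rho> u - ?\<rho> v = (u - v) - (2 * (e \<bullet> (u - v))) *\<^sub>R e"
        by (simp add: reflect_def inner_diff_right algebra_simps)
      then show ?thesis
        using orthogonal_transformation_norm[OF orthogonal_transformation_hyperplane[OF e], of "u - v"]
        by (simp add: dist_norm)
    qed
    have mem: "?\<rho> y \<in> ball (?\<rho> x) r \<longleftrightarrow> y \<in> ball x r" by (simp add: iso)
    have "y \<notin> ball (?\<rho> x) r"
      using iso[of "?\<rho> x" y] \<rho>y_ball by (simp add: reflect_reflect[OF e])
    then have f3y: "f3 y = 0" "f3 (?\<rho> y) = indicator (ball x r) y"
      using mem by (simp_all add: f3_def indicator_def)
    have K0: "?K 0 = 0" by (simp add: inverse_kernel_def)
    have Kle: "?K ?z \<le> ?K (y - x)" if "y \<noteq> x"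
      using inverse_kernel_reflect_le[OF A \<theta> e exponent_bounds(4) that] x y by (simp add: \<Sigma>)
    have Kz: "0 \<le> ?K ?z" "0 \<le> ?K (y - x)" by (rule kernel_nonneg)+
    have "0 \<le> q * \<Theta> powr N * f1 (?\<rho> y)" "0 \<le> \<epsilon> * \<Theta> powr N * f2 (?\<rho> y)"
      using q \<epsilon> by (simp_all add: f1_def f2_def)
    then have l\<rho>: "l (?\<rho> y) \<le> m * c * indicator (ball x r) y"
      unfolding l_def f3y mult_minus_left by linarith
    have Ky: "?K (y - x) \<le> \<Theta> powr N * norm (y - x) powr (- N)" by (rule kernel_le)
    show "l y + l (?\<rho> y) \<le>
      (w y - w x - indicator (ball x r) y * (p \<bullet> (y - x))) * ?K (y - x)
      + (- w y - w x - indicator (ball x r) (?\<rho> y) * (p \<bullet> (?\<rho> y - x))) * ?K (?\<rho> y - x)"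
    proof (cases "y \<in> ball x r")
      case True
      then have ny: "norm (y - x) < r" by (simp add: dist_norm norm_minus_commute)
      define d where "d = q * (norm (y - x))\<^sup>2"
      have d0: "0 \<le> d" using q by (simp add: d_def)
      have "d * ?K (y - x) \<le> d * (\<Theta> powr N * norm (y - x) powr (- N))"
        using Ky d0 by (rule mult_left_mono)
      then have ly: "l y \<le> - (d * ?K (y - x))"
        using True by (simp add: l_def f3y f1_def f2_def d_def mult.commute mult.left_commute)
      have "\<bar>p \<bullet> (y - x)\<bar> \<le> norm p * norm (y - x)" by (rule Cauchy_Schwarz_ineq2)
      also have "\<dots> \<le> 4 * \<epsilon> / r * r"
        using p ny r \<epsilon> by (intro mult_mono) auto
      finally have pz: "p \<bullet> (y - x) \<le> 4 * \<epsilon>" using r by simp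
      \<comment> \<open>The displacement of \<open>x\<close> under the reflection is
        \<open>2 * (e \<bullet> x - b) \<le> 6 * r\<close>, and the isometry adds less than
        \<open>r\<close>.\<close>
      have cK: "c \<le> ?K ?z"
      proof -
        have "norm ?z \<le> norm (?\<rho> y - ?\<rho> x) + norm (?\<rho> x - x)"
          using norm_triangle_ineq[of "?\<rho> y - ?\<rho> x" "?\<rho> x - x"] by simp
        moreover have "norm (?\<rho> y - ?\<rho> x) < r" using iso[of y x] ny by (simp add: dist_norm)
        moreover have "norm (?\<rho> x - x) \<le> 6 * r"
          using far e x by (simp add: reflect_def \<Sigma>)
        ultimately have z7: "norm ?z \<le> 7 * r" by linarith
        have "?z \<noteq> 0" using \<rho>y x by auto
        then have "(7 * r) powr (- N) \<le> norm ?z powr (- N)"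
          using z7 exponent_bounds by (intro powr_mono2') auto
        then have "c \<le> \<theta> powr N * norm ?z powr (- N)"
          unfolding c_def by (intro mult_left_mono) auto
        also have "\<dots> \<le> ?K ?z" using inverse_kernel_bounds(2)[OF A \<theta>] exponent_bounds by simp
        finally show ?thesis .
      qed
      have t: "- d \<le> w y - w x - p \<bullet> (y - x)" using touch[OF True] by (simp add: d_def q_def)
      have gap: "- d * (?K (y - x) - ?K ?z) \<le> (w y - w x - p \<bullet> (y - x)) * (?K (y - x) - ?K ?z)"
      proof (cases "y = x")
        case False
        then show ?thesis using t Kle by (intro mult_right_mono) auto
      qed (simp add: d_def)
      \<comment> \<open>\<open>- 2 * w x\<close> is at least \<open>2 * m - 2 * \<epsilon>\<close>
        and the linear term costs at most \<open>4 * \<epsilon>\<close>, so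
        \<open>6 * \<epsilon> \<le> m\<close> leaves at least \<open>m\<close>.\<close>
      have "m * c \<le> (- 2 * w x - p \<bullet> (y - x)) * ?K ?z"
        using cK c pz wx \<epsilon> by (intro mult_mono) auto
      moreover have "0 \<le> d * ?K ?z" using d0 Kz by simp
      \<comment> \<open>Only the unreflected term is compensated, so forming the difference of
        kernels leaves \<open>- p \<bullet> (y - x)\<close> attached to the reflected
        kernel.\<close>
      moreover have "(w y - w x - p \<bullet> (y - x)) * ?K (y - x) + (- w y - w x) * ?K ?z
          = (w y - w x - p \<bullet> (y - x)) * (?K (y - x) - ?K ?z) + (- 2 * w x - p \<bullet> (y - x)) * ?K ?z"
        by (simp add: algebra_simps)
      moreover have "- d * (?K (y - x) - ?K ?z) = - (d * ?K (y - x)) + d * ?K ?z"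
        by (simp add: algebra_simps)
      ultimately show ?thesis
        using ly l\<rho> gap True \<rho>y_ball by simp
    next
      case False
      then have "y \<noteq> x" using r by auto
      have "\<epsilon> * ?K (y - x) \<le> \<epsilon> * (\<Theta> powr N * norm (y - x) powr (- N))"
        using Ky \<epsilon> by (intro mult_left_mono) auto
      then have ly: "l y \<le> - (\<epsilon> * ?K (y - x))"
        using False by (simp add: l_def f3y f1_def f2_def mult.commute mult.left_commute)
      have "- \<epsilon> * (?K (y - x) - ?K ?z) \<le> (w y - w x) * (?K (y - x) - ?K ?z)"
        using inf[OF y] wx Kle[OF \<open>y \<noteq> x\<close>] by (intro mult_right_mono) auto
      moreover have "0 \<le> - 2 * w x * ?K ?z" using wx \<epsilon> Kz by (intro mult_nonneg_nonneg[of "- 2 * w x"]) auto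
      moreover have "0 \<le> \<epsilon> * ?K ?z" using \<epsilon> Kz by simp
      moreover have "(w y - w x) * ?K (y - x) + (- w y - w x) * ?K ?z
          = (w y - w x) * (?K (y - x) - ?K ?z) + (- 2 * w x) * ?K ?z"
        by (simp add: algebra_simps)
      moreover have "- \<epsilon> * (?K (y - x) - ?K ?z) = - (\<epsilon> * ?K (y - x)) + \<epsilon> * ?K ?z"
        by (simp add: algebra_simps)
      ultimately show ?thesis
        using ly l\<rho> False \<rho>y_ball by simp
    qed
  qed
  finally show ?thesis .
qed

section \<open>The weak and the strong maximum principle when the operator is nonpositive\<close>

context
  assumes C11: "w \<in> C11_loc \<Sigma>"
begin

lemma open_half_space: "open \<Sigma>"
  unfolding \<Sigma> by (rule open_halfspace_gt)

lemma half_space_nonneg: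
  assumes bdd: "bdd_below (w ` \<Sigma>)"
    and F: "\<And>x. x \<in> \<Sigma> \<Longrightarrow> w x < 0 \<Longrightarrow> F_op s \<theta> \<Theta> e w x \<le> 0"
    and x: "x \<in> \<Sigma>"
  shows "0 \<le> w x"
proof (rule ccontr)
  assume neg: "\<not> 0 \<le> w x"
  define m where "m = - Inf (w ` \<Sigma>)"
  have inf: "- m \<le> w y" if "y \<in> \<Sigma>" for y
    using that bdd by (simp add: m_def cINF_lower)
  have m: "0 < m" using inf[OF x] neg by linarith
  obtain C1 where C1: "0 \<le> C1" "\<And>r (x :: real ^ 'n). 0 < r \<Longrightarrow>
      (LINT y|lebesgue. indicator (ball x r) y * ((norm (y - x))\<^sup>2 * norm (y - x) powr (- N)))
        \<le> C1 * r powr (real CARD('n) + 2 - N)"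
    by (rule integral_norm_powr_ball[of N, where 'a="real ^ 'n", unfolded DIM_cart DIM_real mult_1_right,
      OF exponent_bounds(2,3)]) (rule that; blast)
  obtain C2 where C2: "0 \<le> C2" "\<And>r (x :: real ^ 'n). 0 < r \<Longrightarrow>
      (LINT y|lebesgue. indicator (- ball x r) y * norm (y - x) powr (- N)) \<le> C2 * r powr (real CARD('n) - N)"
    by (rule integral_norm_powr_outside_ball[of N, where 'a="real ^ 'n", unfolded DIM_cart DIM_real mult_1_right,
      OF exponent_bounds(1)]) (rule that; blast)
  define a where "a = m * \<theta> powr N * 7 powr (- N) * unit_ball_vol (real CARD('n))"
  define C where "C = \<Theta> powr N * (2 * C1 + C2)"
  have a: "0 < a" using m \<theta> by (simp add: a_def)
  have C: "0 \<le> C" using C1 C2 by (simp add: C_def)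
  \<comment> \<open>The first bound is what \<open>pv_integral_ge_near_infimum\<close> asks for, the
    second gives \<open>\<epsilon> * C < a\<close>. Both are fixed before \<open>x0\<close> and
    \<open>r\<close> are chosen.\<close>
  define \<epsilon> where "\<epsilon> = min (m / 6) (a / (2 * (C + 1)))"
  have \<epsilon>: "0 < \<epsilon>" "6 * \<epsilon> \<le> m" using m a C by (auto simp: \<epsilon>_def)
  have "\<epsilon> * C < a"
  proof -
    have "\<epsilon> * (2 * (C + 1)) \<le> a / (2 * (C + 1)) * (2 * (C + 1))"
      using C by (intro mult_right_mono) (auto simp: \<epsilon>_def)
    then have "\<epsilon> * (2 * (C + 1)) \<le> a" using C by simp
    moreover have "\<epsilon> * C < \<epsilon> * (2 * (C + 1))" using \<epsilon> C by (intro mult_strict_left_mono) auto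
    ultimately show ?thesis by linarith
  qed
  obtain g where g: "\<And>x. x \<in> \<Sigma> \<Longrightarrow> GDERIV w x :> g x"
    and taylor: "\<And>x. x \<in> \<Sigma> \<Longrightarrow> \<exists>\<delta>>0. \<exists>L. \<forall>y. norm (y - x) < \<delta> \<longrightarrow>
      \<bar>w y - w x - g x \<bullet> (y - x)\<bar> \<le> L * (norm (y - x))\<^sup>2"
    using C11_loc_taylor[OF C11 open_half_space] by blast
  have "Inf (w ` \<Sigma>) < - m + \<epsilon>" using \<epsilon> by (simp add: m_def)
  then obtain x0 where x0: "x0 \<in> \<Sigma>" "w x0 < - m + \<epsilon>"
    using cInf_lessD[of "w ` \<Sigma>"] x by blast
  \<comment> \<open>Half the distance of \<open>x0\<close> to the hyperplane. Points of
    \<open>cball x0 r\<close> then have distance between \<open>r\<close> and \<open>3 * r\<close>,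
    so the open ball of radius \<open>r\<close> about the minimum point stays in
    \<open>\<Sigma>\<close>.\<close>
  define r where "r = (e \<bullet> x0 - b) / 2"
  have r: "0 < r" using x0 by (simp add: r_def \<Sigma>)
  have near: "\<bar>e \<bullet> y - e \<bullet> v\<bar> \<le> norm (y - v)" for y v
    using Cauchy_Schwarz_ineq2[of e "y - v"] e by (simp add: inner_diff_right)
  have sub: "cball x0 r \<subseteq> \<Sigma>"
  proof
    fix y assume "y \<in> cball x0 r"
    then have "norm (y - x0) \<le> r" by (simp add: dist_norm norm_minus_commute)
    with near[of y x0] have "e \<bullet> x0 - r \<le> e \<bullet> y" by linarith
    moreover have "b < e \<bullet> x0 - r" using r by (simp add: r_def field_simps)
    ultimately show "y \<in> \<Sigma>" by (simp add: \<Sigma>)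
  qed
  txt \<open>The infimum of \<open>w\<close> need not be attained; the quadratic penalty exceeds \<open>\<epsilon>\<close> on the boundary
    of \<open>cball x0 r\<close>, which makes the minimum of \<open>v\<close> over the ball global in \<open>\<Sigma>\<close>.\<close>
  define v where "v y = w y + 2 * \<epsilon> / r\<^sup>2 * (norm (y - x0))\<^sup>2" for y
  have "continuous_on (cball x0 r) w"
  proof (rule continuous_at_imp_continuous_on, rule ballI)
    fix y assume "y \<in> cball x0 r"
    then have "GDERIV w y :> g y" using sub g by blast
    then show "isCont w y" unfolding gderiv_def by (rule has_derivative_continuous)
  qed
  then have "continuous_on (cball x0 r) v" unfolding v_def by (intro continuous_intros)
  then obtain x1 where x1: "x1 \<in> cball x0 r" and min_ball: "\<And>y. y \<in> cball x0 r \<Longrightarrow> v x1 \<le> v y"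
    using continuous_attains_inf[of "cball x0 r" v] r by auto
  have x1S: "x1 \<in> \<Sigma>" using x1 sub by blast
  have vx1: "v x1 < - m + \<epsilon>" using min_ball[of x0] r x0 by (simp add: v_def)
  have min: "v x1 \<le> v y" if y: "y \<in> \<Sigma>" for y
  proof (cases "y \<in> cball x0 r")
    case False
    then have "r\<^sup>2 \<le> (norm (y - x0))\<^sup>2"
      using r by (intro power_mono) (auto simp: dist_norm norm_minus_commute)
    then have "2 * \<epsilon> / r\<^sup>2 * r\<^sup>2 \<le> 2 * \<epsilon> / r\<^sup>2 * (norm (y - x0))\<^sup>2"
      using \<epsilon> by (intro mult_left_mono) auto
    then have "2 * \<epsilon> \<le> 2 * \<epsilon> / r\<^sup>2 * (norm (y - x0))\<^sup>2" using r by simp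
    then show ?thesis using vx1 inf[OF y] \<epsilon> by (simp add: v_def)
  qed (rule min_ball)
  have wx1: "w x1 \<le> - m + \<epsilon>"
  proof -
    have "w x1 \<le> v x1" using \<epsilon> by (simp add: v_def)
    then show ?thesis using vx1 by simp
  qed
  define p where "p = g x1"
  \<comment> \<open>The gradient of \<open>v\<close> vanishes at its minimum point, so the gradient
    \<open>p\<close> of \<open>w\<close> there is minus that of the penalty, which has norm at most
    \<open>4 * \<epsilon> / r\<close>.\<close>
  have "GDERIV v x1 :> p + (4 * \<epsilon> / r\<^sup>2) *\<^sub>R (x1 - x0)"
  proof -
    have "((\<lambda>y. w y + q * ((y - x0) \<bullet> (y - x0))) has_derivative (\<lambda>h. h \<bullet> p + q * (2 * ((x1 - x0) \<bullet> h)))) (at x1)" for q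
      using g[OF x1S] unfolding gderiv_def p_def
      by (auto intro!: derivative_eq_intros simp: inner_commute)
    from this[of "2 * \<epsilon> / r\<^sup>2"]
    have "(v has_derivative (\<lambda>h. h \<bullet> p + 2 * \<epsilon> / r\<^sup>2 * (2 * ((x1 - x0) \<bullet> h)))) (at x1)"
      unfolding v_def power2_norm_eq_inner .
    then show ?thesis
      unfolding gderiv_def by (simp add: inner_add_right inner_commute algebra_simps)
  qed
  then have "p + (4 * \<epsilon> / r\<^sup>2) *\<^sub>R (x1 - x0) = 0"
    using GDERIV_critical_point[OF _ open_half_space x1S] min by blast
  then have p: "p = - (4 * \<epsilon> / r\<^sup>2) *\<^sub>R (x1 - x0)"
    by (simp add: eq_neg_iff_add_eq_0)
  have np: "norm p \<le> 4 * \<epsilon> / r"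
  proof -
    have "norm p = 4 * \<epsilon> / r\<^sup>2 * norm (x1 - x0)" using \<epsilon> by (simp add: p)
    also have "\<dots> \<le> 4 * \<epsilon> / r\<^sup>2 * r"
      using x1 \<epsilon> by (intro mult_left_mono) (auto simp: dist_norm norm_minus_commute)
    finally show ?thesis using r by (simp add: power2_eq_square)
  qed
  \<comment> \<open>Minimality of \<open>v\<close> at \<open>x1\<close>, with the penalty expanded
    about \<open>x1\<close> instead of \<open>x0\<close>: its first-order part is exactly
    \<open>- p \<bullet> (y - x1)\<close>.\<close>
  have touch: "p \<bullet> (y - x1) - 2 * \<epsilon> / r\<^sup>2 * (norm (y - x1))\<^sup>2 \<le> w y - w x1" if "y \<in> \<Sigma>" for y
  proof -
    have "(norm (y - x0))\<^sup>2 = (norm (x1 - x0))\<^sup>2 + 2 * ((x1 - x0) \<bullet> (y - x1)) + (norm (y - x1))\<^sup>2"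
      unfolding power2_norm_eq_inner
      by (simp add: inner_diff_left inner_diff_right inner_commute)
    moreover have "p \<bullet> (y - x1) = - (2 * (2 * \<epsilon> / r\<^sup>2)) * ((x1 - x0) \<bullet> (y - x1))"
      unfolding p inner_scaleR_left by simp
    moreover have "q * (t + 2 * u + v) = q * t - (- (2 * q) * u) + q * v" for q t u v :: real
      by algebra
    ultimately have "2 * \<epsilon> / r\<^sup>2 * (norm (y - x0))\<^sup>2 = 2 * \<epsilon> / r\<^sup>2 * (norm (x1 - x0))\<^sup>2
        - p \<bullet> (y - x1) + 2 * \<epsilon> / r\<^sup>2 * (norm (y - x1))\<^sup>2"
      by (simp only:)
    then show ?thesis using min[OF that] by (simp add: v_def)
  qed
  have e1: "\<bar>e \<bullet> x1 - e \<bullet> x0\<bar> \<le> r"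
    using near[of x1 x0] x1 by (simp add: dist_norm norm_minus_commute)
  have e0: "e \<bullet> x0 - b = 2 * r" by (simp add: r_def)
  have sub1: "ball x1 r \<subseteq> \<Sigma>"
  proof
    fix y assume "y \<in> ball x1 r"
    then have "norm (y - x1) < r" by (simp add: dist_norm norm_minus_commute)
    with near[of y x1] e1 e0 show "y \<in> \<Sigma>" unfolding \<Sigma> mem_Collect_eq by linarith
  qed
  obtain \<delta> L where \<delta>: "0 < \<delta>" "\<And>y. norm (y - x1) < \<delta> \<Longrightarrow>
      \<bar>w y - w x1 - p \<bullet> (y - x1)\<bar> \<le> L * (norm (y - x1))\<^sup>2"
    using taylor[OF x1S] unfolding p_def by blast
  have "r powr (- 2 * s) * (a - \<epsilon> * C) \<le> F_op s \<theta> \<Theta> e w x1"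
  proof (rule F_op_ge[where N=N])
    fix A assume "A \<in> admissible \<theta> \<Theta> e"
    then show "r powr (- 2 * s) * (a - \<epsilon> * C)
        \<le> pv_integral (\<lambda>y. (w y - w x1) * inverse_kernel N A (y - x1)) x1"
      using pv_integral_ge_near_infimum[OF _ r \<delta> sub1 _ \<epsilon> inf wx1 np touch C1(2) C2(2)] sub1 e1 e0
      by (simp add: a_def C_def mult.assoc subset_iff)
  qed (use \<theta> e N in auto)
  moreover have "0 < r powr (- 2 * s) * (a - \<epsilon> * C)" using r \<open>\<epsilon> * C < a\<close> by simp
  moreover have "F_op s \<theta> \<Theta> e w x1 \<le> 0" using F[OF x1S] wx1 \<epsilon> by simp
  ultimately show False by linarith
qed

text \<open>As \<open>x\<close> is a minimum point, the gradient vanishes there and the folded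
  integrand is \<open>w y\<close> times a kernel difference. If \<open>w y0 > 0\<close>, this
  product is at least \<open>\<eta> * \<kappa>\<close> on a ball about \<open>y0\<close>, uniformly
  in the matrix, and the operator is positive at \<open>x\<close>.\<close>

lemma half_space_zero:
  assumes nonneg: "\<And>y. y \<in> \<Sigma> \<Longrightarrow> 0 \<le> w y"
    and x: "x \<in> \<Sigma>" "w x = 0" "F_op s \<theta> \<Theta> e w x \<le> 0"
    and y0: "y0 \<in> \<Sigma>"
  shows "w y0 = 0"
proof (rule ccontr)
  assume "w y0 \<noteq> 0"
  with nonneg[OF y0] have pos: "0 < w y0" by simp
  obtain g where g: "\<And>x. x \<in> \<Sigma> \<Longrightarrow> GDERIV w x :> g x"
    and taylor: "\<And>x. x \<in> \<Sigma> \<Longrightarrow> \<exists>\<delta>>0. \<exists>L. \<forall>y. norm (y - x) < \<delta> \<longrightarrow>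
      \<bar>w y - w x - g x \<bullet> (y - x)\<bar> \<le> L * (norm (y - x))\<^sup>2"
    using C11_loc_taylor[OF C11 open_half_space] by blast
  have "g x = 0"
    using GDERIV_critical_point[OF g[OF x(1)] open_half_space x(1)] nonneg x(2) by simp
  then obtain \<delta> L where \<delta>: "0 < \<delta>" "\<And>y. norm (y - x) < \<delta> \<Longrightarrow>
      \<bar>w y - w x - 0 \<bullet> (y - x)\<bar> \<le> L * (norm (y - x))\<^sup>2"
    using taylor[OF x(1)] by metis
  \<comment> \<open>\<open>\<eta>\<close> and \<open>h\<close> are half the value of
    \<open>w\<close> and half the distance to the hyperplane at \<open>y0\<close>, so by continuity
    both are exceeded on a whole ball.\<close>
  define \<eta> where "\<eta> = w y0 / 2"
  define h where "h = (e \<bullet> y0 - b) / 2"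
  have h: "0 < h" using y0 by (simp add: h_def \<Sigma>)
  have "isCont w y0" using g[OF y0] by (auto simp: gderiv_def intro: has_derivative_continuous)
  then have "\<forall>\<^sub>F y in nhds y0. \<eta> < w y"
    using pos by (intro order_tendstoD(1)) (auto simp: isCont_def tendsto_at_iff_tendsto_nhds \<eta>_def)
  moreover have "\<forall>\<^sub>F y in nhds y0. b + h < e \<bullet> y"
  proof (rule order_tendstoD(1))
    have "isCont (\<lambda>y. e \<bullet> y) y0" by (intro continuous_intros)
    then show "((\<lambda>y. e \<bullet> y) \<longlongrightarrow> e \<bullet> y0) (nhds y0)"
      by (simp add: isCont_def tendsto_at_iff_tendsto_nhds)
  qed (use h in \<open>simp add: h_def field_simps\<close>)
  ultimately have "\<forall>\<^sub>F y in nhds y0. \<eta> < w y \<and> b + h < e \<bullet> y"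
    by (rule eventually_conj)
  then obtain \<sigma> where \<sigma>: "0 < \<sigma>" and near: "\<And>y. y \<in> ball y0 \<sigma> \<Longrightarrow> \<eta> < w y \<and> b + h < e \<bullet> y"
    unfolding eventually_nhds_metric by (auto simp: dist_commute)
  \<comment> \<open>\<open>R\<close> bounds \<open>norm (y - x)\<close> for \<open>y\<close> in the
    ball, and \<open>\<kappa>\<close> is the kernel gap for these data. It is positive because
    \<open>a\<close> is.\<close>
  define R where "R = norm (y0 - x) + \<sigma>"
  define U where "U = (R / \<theta>)\<^sup>2"
  define a where "a = 4 / \<Theta>\<^sup>2 * ((e \<bullet> x - b) * h)"
  define \<kappa> where "\<kappa> = U powr (- (N / 2)) * (1 - (U / (U + a)) powr (N / 2))"
  have R: "0 < R" using \<sigma> by (simp add: R_def add_nonneg_pos)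
  have U: "0 < U" using R \<theta> by (simp add: U_def)
  have a: "0 < a" using x(1) h \<theta> by (simp add: a_def \<Sigma>)
  have "(U / (U + a)) powr (N / 2) < 1"
    using U a exponent_bounds powr_less_mono2[of "N / 2" "U / (U + a)" 1] by (auto simp: divide_simps)
  then have \<kappa>: "0 < \<kappa>" using U by (simp add: \<kappa>_def)
  have \<eta>: "0 < \<eta>" using pos by (simp add: \<eta>_def)
  define l where "l y = \<eta> * \<kappa> * indicator (ball y0 \<sigma>) y" for y
  have "integrable lebesgue (indicator (ball y0 \<sigma>) :: real ^ 'n \<Rightarrow> real)"
    by (simp flip: lmeasurable_iff_integrable)
  then have l: "integrable lebesgue l" unfolding l_def by (rule integrable_mult_right)
  have l_int: "(LINT y|lebesgue. l y) = \<eta> * \<kappa> * measure lebesgue (ball y0 \<sigma>)"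
    unfolding l_def by simp
  have "(LINT y|lebesgue. l y) \<le> F_op s \<theta> \<Theta> e w x"
  proof (rule F_op_ge[where N=N])
    fix A assume A: "A \<in> admissible \<theta> \<Theta> e"
    show "(LINT y|lebesgue. l y)
      \<le> pv_integral (\<lambda>y. (w y - w x) * inverse_kernel N A (y - x)) x"
    proof (rule pv_integral_ge[OF A zero_less_one \<delta> l])
      fix y assume y: "y \<in> \<Sigma>"
      let ?D = "inverse_kernel N A (y - x) - inverse_kernel N A (reflect e b y - x)"
      have "reflect e b y \<notin> ball y0 \<sigma>"
        using near[of "reflect e b y"] y h by (auto simp: \<Sigma> inner_reflect[OF e])
      then have "l y + l (reflect e b y) = \<eta> * \<kappa> * indicator (ball y0 \<sigma>) y"
        by (simp add: l_def)
      also have "\<dots> \<le> w y * ?D"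
      proof (cases "y \<in> ball y0 \<sigma>")
        case True
        then have "norm (y - y0) < \<sigma>" by (simp add: dist_norm norm_minus_commute)
        then have yR: "norm (y - x) \<le> R"
          using norm_triangle_ineq[of "y - y0" "y0 - x"] by (simp add: R_def)
        have yx: "y \<noteq> x" using near[OF True] x(2) \<eta> by auto
        have h': "0 \<le> (e \<bullet> x - b) * h" "(e \<bullet> x - b) * h \<le> (e \<bullet> x - b) * (e \<bullet> y - b)"
          using near[OF True] x(1) h by (auto simp: \<Sigma> intro!: mult_left_mono)
        have "\<kappa> \<le> ?D"
          unfolding \<kappa>_def U_def a_def
          using inverse_kernel_reflect_gap[OF A \<theta> e exponent_bounds(4) yx yR h'] by simp
        then have "\<eta> * \<kappa> \<le> w y * ?D"
          using near[OF True] \<eta> \<kappa> by (intro mult_mono) auto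
        then show ?thesis using True by simp
      next
        case False
        \<comment> \<open>At \<open>y = x\<close> the kernel difference has no useful sign, but
          \<open>w x = 0\<close>.\<close>
        have "0 \<le> w y * ?D"
        proof (cases "y = x")
          case False
          have "0 \<le> ?D"
            using inverse_kernel_reflect_le[OF A \<theta> e exponent_bounds(4) False, of b] x(1) y by (simp add: \<Sigma>)
          then show ?thesis using nonneg[OF y] by simp
        qed (simp add: x(2))
        then show ?thesis using False by simp
      qed
      finally show "l y + l (reflect e b y) \<le>
        (w y - w x - indicator (ball x 1) y * (0 \<bullet> (y - x))) * inverse_kernel N A (y - x)
        + (- w y - w x - indicator (ball x 1) (reflect e b y) * (0 \<bullet> (reflect e b y - x)))
          * inverse_kernel N A (reflect e b y - x)"
        by (simp add: x(2) algebra_simps)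
    qed
  qed (use \<theta> e N in auto)
  moreover have "0 < (LINT y|lebesgue. l y)"
    unfolding l_int using \<eta> \<kappa> content_ball_pos[OF \<sigma>] by simp
  ultimately show False using x(3) by linarith
qed

end

end

text \<open>Where \<open>w\<close> is negative, \<open>c x * w x \<le> 0\<close>, so the
  differential inequality gives \<open>F_op s \<theta> \<Theta> e w x \<le> 0\<close> and the
  zero-order term disappears. Oddness carries vanishing on \<open>\<Sigma>\<close> to the opposite
  side.\<close>

lemma maximum_principle_half_space:
  fixes e :: "real ^ 'n"
  assumes "CARD('n) \<ge> 2" "0 < s" "s < 1" "0 < \<theta>" "\<theta> \<le> \<Theta>" and e: "norm e = 1"
    and \<Sigma>: "\<Sigma> = {x. b < e \<bullet> x}"
    and "w \<in> L_space s" "w \<in> C11_loc \<Sigma>" "bdd_below (w ` \<Sigma>)"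
    and odd: "\<forall>x\<in>\<Sigma>. w (reflect e b x) = - w x"
    and c: "\<forall>x\<in>\<Sigma>. w x < 0 \<longrightarrow> 0 \<le> c x"
    and F: "\<forall>x\<in>\<Sigma>. w x < 0 \<longrightarrow> F_op s \<theta> \<Theta> e w x - c x * w x \<le> 0"
  shows "(\<forall>x\<in>\<Sigma>. 0 \<le> w x) \<and>
    ((\<forall>x\<in>\<Sigma>. w x = 0 \<longrightarrow> F_op s \<theta> \<Theta> e w x \<le> 0) \<longrightarrow>
      ((\<forall>x\<in>\<Sigma>. 0 < w x) \<or> (\<forall>x. e \<bullet> x \<noteq> b \<longrightarrow> w x = 0)) \<and>
      ((\<forall>x\<in>{x. e \<bullet> x = b}. w (reflect e b x) = - w x) \<longrightarrow> (\<forall>x\<in>\<Sigma>. 0 < w x) \<or> (\<forall>x. w x = 0)))"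
proof -
  have oddI: "w (reflect e b x) = - w x" if "x \<in> \<Sigma>" for x using odd that by blast
  have F': "F_op s \<theta> \<Theta> e w x \<le> 0" if "x \<in> \<Sigma>" "w x < 0" for x
  proof -
    have "c x * w x \<le> 0" using c that by (simp add: mult_nonneg_nonpos)
    moreover have "F_op s \<theta> \<Theta> e w x - c x * w x \<le> 0" using F that by blast
    ultimately show ?thesis by linarith
  qed
  note ctxt = assms(1-5) e refl \<Sigma> assms(8) oddI assms(9)
  have nonneg: "0 \<le> w x" if "x \<in> \<Sigma>" for x
    using half_space_nonneg[OF ctxt assms(10) F' that] .
  have zero: "w y = 0" if "x \<in> \<Sigma>" "w x = 0" "F_op s \<theta> \<Theta> e w x \<le> 0" "y \<in> \<Sigma>" for x y
    using half_space_zero[OF ctxt nonneg that] .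
  have off: "w x = 0" if "\<forall>y\<in>\<Sigma>. w y = 0" "e \<bullet> x \<noteq> b" for x
  proof (cases "b < e \<bullet> x")
    case False
    then have "reflect e b x \<in> \<Sigma>" using that(2) by (simp add: \<Sigma> inner_reflect[OF e])
    then show ?thesis using that(1) odd by (metis reflect_reflect[OF e] neg_equal_0_iff_equal)
  qed (use that in \<open>simp add: \<Sigma>\<close>)
  have on: "w x = 0" if "w (reflect e b x) = - w x" "e \<bullet> x = b" for x
    using that by (simp add: reflect_def)
  have "(\<forall>x\<in>\<Sigma>. 0 < w x) \<or> (\<forall>x\<in>\<Sigma>. w x = 0)"
    if "\<forall>x\<in>\<Sigma>. w x = 0 \<longrightarrow> F_op s \<theta> \<Theta> e w x \<le> 0"
    using that zero nonneg by (metis less_le)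
  then show ?thesis using nonneg off on by blast
qed

text \<open>Reflection fixes \<open>T\<close> pointwise, so oddness in \<open>\<Sigma>\<close>
  carries no information about \<open>w\<close> on \<open>T\<close>. Hence vanishing is asserted off
  \<open>T\<close>, and everywhere once oddness also holds on \<open>T\<close>, where it reads
  \<open>w x = - w x\<close>.\<close>

theorem theorem2p9:
  fixes s \<theta> \<Theta> b :: real
    and e :: "real ^ 'n"
    and T \<Sigma> :: "(real ^ 'n) set"
    and w c :: "real ^ 'n \<Rightarrow> real"
  assumes "CARD('n) \<ge> 2"
    and "0 < s" and "s < 1"
    and "0 < \<theta>" and "\<theta> \<le> \<Theta>"
    and "norm e = 1"
    and "T = {x. e \<bullet> x = b}"
    and "\<Sigma> = {x. b < e \<bullet> x} \<or> \<Sigma> = {x. e \<bullet> x < b}"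
    and "w \<in> L_space s" and "w \<in> C11_loc \<Sigma>"
    and "bdd_below (w ` \<Sigma>)"
    and "\<forall>x\<in>\<Sigma>. w (reflect e b x) = - w x"
    and "\<forall>x\<in>\<Sigma>. w x < 0 \<longrightarrow> 0 \<le> c x"
    and "\<forall>x\<in>\<Sigma>. w x < 0 \<longrightarrow> F_op s \<theta> \<Theta> e w x - c x * w x \<le> 0"
  shows "(\<forall>x\<in>\<Sigma>. 0 \<le> w x) \<and>
    ((\<forall>x\<in>\<Sigma>. w x = 0 \<longrightarrow> F_op s \<theta> \<Theta> e w x \<le> 0) \<longrightarrow>
      ((\<forall>x\<in>\<Sigma>. 0 < w x) \<or> (\<forall>x. x \<notin> T \<longrightarrow> w x = 0)) \<and>
      ((\<forall>x\<in>T. w (reflect e b x) = - w x) \<longrightarrow> (\<forall>x\<in>\<Sigma>. 0 < w x) \<or> (\<forall>x. w x = 0)))"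
proof -
  consider "\<Sigma> = {x. b < e \<bullet> x}" | "\<Sigma> = {x. - b < (- e) \<bullet> x}" using assms(8) by auto
  then show ?thesis
  proof cases
    case 1
    then show ?thesis
      using maximum_principle_half_space[OF assms(1-6) _ assms(9-14)] by (simp add: assms(7))
  next
    case 2
    \<comment> \<open>Changing the sign of both \<open>e\<close> and \<open>b\<close> swaps the two
      half-spaces and preserves the reflection and the set of admissible matrices.\<close>
    have R: "reflect (- e) (- b) = reflect e b"
      by (rule ext) (simp add: reflect_def algebra_simps)
    have "is_eigenvector A (- e) = is_eigenvector A e" for A :: "real ^ 'n ^ 'n"
    proof -
      have "A *v (- e) = - (A *v e)" using matrix_vector_mult_diff_distrib[of A 0 e] by simp
      then show ?thesis by (simp add: is_eigenvector_def)
    qed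
    then have "F_op s \<theta> \<Theta> (- e) = F_op s \<theta> \<Theta> e"
      by (intro ext) (simp add: F_op_def admissible_def)
    then show ?thesis
      using maximum_principle_half_space[of s \<theta> \<Theta> "- e" \<Sigma> "- b" w c] 2 assms
      by (simp add: R)
  qed
qed

end
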